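(* Let $R\ge 1$ and $n=2^R+2^{R-1}$. Then $\delta(n)=2$ if $n=3$, $\delta(n)=8$ if $n=6$, and $\delta(n)=0$ otherwise. Explicitly, $a_1(n)=2$ and $a_3(n)=0$ if $R=1$; $a_1(n)=8$ and $a_3(n)=0$ if $R=2$; and $a_1(n)=a_3(n)=4^{R-1}$ if $R\ge 3$.
   Context: For a partition $\lambda$, $f^\lambda$ denotes the number of standard Young tableaux of shape $\lambda$. $a_i(n)$ is the number of partitions $\lambda$ of $n$ with $f^\lambda\equiv i\pmod 4$, and $\delta(n):=a_1(n)-a_3(n)$. *)

theory Defs
  imports Main
begin

definition partitions :: "nat \<Rightarrow> nat list set" where
  "partitions n = {lam. sorted_wrt (\<ge>) lam \<and> (\<forall>x\<in>set lam. 0 < x) \<and> sum_list lam = n}"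

definition young_cells :: "nat list \<Rightarrow> (nat \<times> nat) set" where
  "young_cells lam = {(i, j). i < length lam \<and> j < lam ! i}"

text \<open>Standard Young tableaux of shape lam: bijective fillings of the cells with
  1..|lam|, strictly increasing along rows and down columns (extended by 0 outside
  the diagram so that the set is finite).\<close>
definition syt :: "nat list \<Rightarrow> (nat \<times> nat \<Rightarrow> nat) set" where
  "syt lam = {T. bij_betw T (young_cells lam) {1..sum_list lam}
     \<and> (\<forall>c. c \<notin> young_cells lam \<longrightarrow> T c = 0)
     \<and> (\<forall>i j. (i, Suc j) \<in> young_cells lam \<longrightarrow> T (i, j) < T (i, Suc j))
     \<and> (\<forall>i j. (Suc i, j) \<in> young_cells lam \<longrightarrow> T (i, j) < T (Suc i, j))}"

definition f_lam :: "nat list \<Rightarrow> nat" where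
  "f_lam lam = card (syt lam)"

definition a_cnt :: "nat \<Rightarrow> nat \<Rightarrow> nat" where
  "a_cnt i n = card {lam \<in> partitions n. f_lam lam mod 4 = i}"

definition delta :: "nat \<Rightarrow> int" where
  "delta n = int (a_cnt 1 n) - int (a_cnt 3 n)"

end

theory Submission
  imports Defs "HOL-Number_Theory.Cong"
begin

text \<open>
  By the branching rule, \<open>f_lam\<close> is the coefficient of an exponent vector (the beta set of the
  partition) in \<open>p\<^sub>1\<^sup>n a\<^sub>\<delta>\<close>, where \<open>p\<^sub>r\<close> is a power sum and \<open>a\<^sub>\<delta>\<close> the Vandermonde alternant. From
  \<open>p\<^sub>r\<^sup>2 = p\<^sub>2\<^sub>r + 2 e\<close> one gets \<open>p\<^sub>r\<^sup>4 \<equiv> p\<^sub>2\<^sub>r\<^sup>2\<close> modulo 4, so for \<open>n = 3M\<close> with \<open>M\<close> a power of 2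
  the factor of exponent \<open>2M\<close> may be replaced by \<open>p\<^sub>M\<^sup>2\<close>, and modulo 2 everything by \<open>p\<^sub>M\<^sup>3\<close>. The
  Murnaghan--Nakayama rule then shows that the odd partitions are those with empty \<open>M\<close>-core whose
  \<open>M\<close>-quotient is \<open>(3)\<close> or \<open>(1,1,1)\<close> on one runner, or \<open>(2)\<close> or \<open>(1,1)\<close> on one runner and \<open>(1)\<close>
  on another. Modulo 4 their values are signs times the value \<open>c\<^sub>i\<close> of a hook of size \<open>M\<close>; summing the
  signs gives \<open>\<delta> = 4 \<Sum> c\<^sub>i\<close> for \<open>M > 1\<close>, and \<open>c\<^sub>i\<close> is \<open>(-1)\<^sup>i\<close> on the first half of the runners and
  \<open>- (-1)\<^sup>i\<close> on the second half.
\<close>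

section \<open>Lowering operators\<close>

text \<open>Multiplication by the power sum \<open>p\<^sub>r\<close>, acting on coefficients: \<open>F\<close> gives the coefficient of
  each exponent vector. The exponents are integers so that subtraction does not truncate.\<close>

primrec lower :: "int \<Rightarrow> (int list \<Rightarrow> int) \<Rightarrow> int list \<Rightarrow> int" where
  "lower r F [] = 0"
| "lower r F (x # xs) = F ((x - r) # xs) + lower r (\<lambda>ys. F (x # ys)) xs"

text \<open>The action of \<open>e\<close> in
  \<open>p\<^sub>r\<^sup>2 = p\<^sub>2\<^sub>r + 2 e\<close>: multiplication by the second
  elementary symmetric polynomial in the \<open>r\<close>-th powers of the variables.\<close>

primrec lower_pairs :: "int \<Rightarrow> (int list \<Rightarrow> int) \<Rightarrow> int list \<Rightarrow> int" where
  "lower_pairs r F [] = 0"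
| "lower_pairs r F (x # xs) =
     lower r (\<lambda>ys. F ((x - r) # ys)) xs + lower_pairs r (\<lambda>ys. F (x # ys)) xs"

lemma lower_add: "lower r (\<lambda>xs. F xs + G xs) xs = lower r F xs + lower r G xs"
  by (induction xs arbitrary: F G) auto

lemma lower_mult: "lower r (\<lambda>xs. c * F xs) xs = c * lower r F xs"
  by (induction xs arbitrary: F) (auto simp: algebra_simps)

lemma lower_uminus: "lower r (\<lambda>xs. - F xs) xs = - lower r F xs"
  using lower_mult[of r "-1" F xs] by simp

lemma lower_cong_mod:
  assumes "\<And>ys. [F ys = G ys] (mod m)"
  shows "[lower r F xs = lower r G xs] (mod m)"
  using assms by (induction xs arbitrary: F G) (auto intro!: cong_add)

lemma funpow_lower_cong_mod:
  assumes "\<And>ys. [F ys = G ys] (mod m)"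
  shows "[(lower r ^^ n) F xs = (lower r ^^ n) G xs] (mod m)"
  using assms by (induction n arbitrary: F G xs) (auto intro!: lower_cong_mod)

lemma lower_commute: "lower a (lower b F) xs = lower b (lower a F) xs"
  by (induction xs arbitrary: F) (auto simp: lower_add algebra_simps)

lemma lower_lower: "lower r (lower r F) xs = lower (2 * r) F xs + 2 * lower_pairs r F xs"
  by (induction xs arbitrary: F) (auto simp: lower_add)

text \<open>By \<open>lower_lower\<close>, twice \<open>lower_pairs\<close> is a difference of
  composed lowering operators, and these commute. Over the integers the factor 2 can be
  cancelled.\<close>

lemma lower_pairs_commute:
  "lower_pairs r (lower s F) xs = lower s (lower_pairs r F) xs"
proof -
  have "2 * lower_pairs r (lower s F) xs = lower r (lower r (lower s F)) xs - lower (2 * r) (lower s F) xs"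
    by (simp add: lower_lower)
  also have "lower r (lower r (lower s F)) = lower s (lower r (lower r F))"
    by (simp add: lower_commute[abs_def, of r s])
  also have "lower r (lower r F) = (\<lambda>xs. lower (2 * r) F xs + 2 * lower_pairs r F xs)"
    by (rule ext) (rule lower_lower)
  also have "lower s \<dots> xs - lower (2 * r) (lower s F) xs = 2 * lower s (lower_pairs r F) xs"
    using lower_commute[of s "2 * r" F xs] by (simp add: lower_add lower_mult)
  finally show ?thesis by simp
qed

text \<open>Squaring \<open>P^2 = Q + 2 E\<close> lifts a congruence modulo 2 to one modulo 4. The
  cross terms \<open>2 Q E\<close> and \<open>2 E Q\<close> add up to a multiple of 4 because
  \<open>E\<close> commutes with \<open>Q\<close>.\<close>

lemma lower_power4_cong:
  "[(lower r ^^ 4) F xs = (lower (2 * r) ^^ 2) F xs] (mod 4)"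
proof -
  let ?P = "lower r" and ?Q = "lower (2 * r)" and ?E = "lower_pairs r"
  have "(?P ^^ 4) F xs = ?P (?P (?P (?P F))) xs"
    by (simp add: eval_nat_numeral)
  also have "?P (?P F) = (\<lambda>xs. ?Q F xs + 2 * ?E F xs)"
    by (rule ext) (rule lower_lower)
  also have "?P (?P \<dots>) xs = ?Q (?Q F) xs + 4 * (?E (?Q F) xs + ?E (?E F) xs)"
  proof -
    have "?P (\<lambda>xs. ?Q F xs + 2 * ?E F xs) = (\<lambda>xs. ?P (?Q F) xs + 2 * ?P (?E F) xs)"
      by (rule ext) (simp add: lower_add lower_mult)
    then have "?P (?P (\<lambda>xs. ?Q F xs + 2 * ?E F xs)) xs = ?P (\<lambda>xs. ?P (?Q F) xs + 2 * ?P (?E F) xs) xs"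
      by simp
    also have "\<dots> = ?P (?P (?Q F)) xs + 2 * ?P (?P (?E F)) xs"
      by (simp add: lower_add lower_mult)
    finally show ?thesis
      by (simp add: lower_lower[of r] lower_pairs_commute)
  qed
  also have "[\<dots> = ?Q (?Q F) xs] (mod 4)"
    by (simp add: cong_iff_dvd_diff)
  finally show ?thesis by (simp add: eval_nat_numeral)
qed

lemma lower_square_cong:
  "[(lower r ^^ 2) F xs = lower (2 * r) F xs] (mod 2)"
  by (simp add: eval_nat_numeral lower_lower cong_iff_dvd_diff)

text \<open>The copies of \<open>A\<close> are replaced from the outside in. The outermost one is
  exchanged for \<open>B\<close> at an unchanged argument, so only \<open>B\<close> has to respect
  congruences.\<close>

lemma funpow_cong_mod:
  fixes A B :: "(int list \<Rightarrow> int) \<Rightarrow> int list \<Rightarrow> int"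
  assumes "\<And>F xs. [A F xs = B F xs] (mod m)"
    and "\<And>F G xs. (\<And>ys. [F ys = G ys] (mod m)) \<Longrightarrow> [B F xs = B G xs] (mod m)"
  shows "[(A ^^ n) F xs = (B ^^ n) F xs] (mod m)"
proof (induction n arbitrary: xs)
  case (Suc n)
  have "[A ((A ^^ n) F) xs = B ((A ^^ n) F) xs] (mod m)" by (rule assms)
  also have "[B ((A ^^ n) F) xs = B ((B ^^ n) F) xs] (mod m)" by (rule assms) (rule Suc)
  finally show ?case by simp
qed simp

text \<open>The lowerings are regrouped in blocks of four, each of which becomes two lowerings by
  twice the amount; hence \<open>r\<close> is arbitrary in the induction. The last square stays,
  since \<open>lower_square_cong\<close> merges two lowerings only modulo 2.\<close>

lemma lower_power_of_2_mod4:
  "[(lower r ^^ (2 * 2 ^ a)) F xs = (lower (2 ^ a * r) ^^ 2) F xs] (mod 4)"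
proof (induction a arbitrary: r xs)
  case (Suc a)
  have "(lower r ^^ (2 * 2 ^ Suc a)) F xs = ((lower r ^^ 4) ^^ 2 ^ a) F xs"
    by (simp add: funpow_mult mult.commute)
  also have "[\<dots> = ((lower (2 * r) ^^ 2) ^^ 2 ^ a) F xs] (mod 4)"
    by (intro funpow_cong_mod lower_power4_cong funpow_lower_cong_mod)
  also have "((lower (2 * r) ^^ 2) ^^ 2 ^ a) F xs = (lower (2 * r) ^^ (2 * 2 ^ a)) F xs"
    by (simp add: funpow_mult mult.commute)
  also have "[\<dots> = (lower (2 ^ a * (2 * r)) ^^ 2) F xs] (mod 4)" by (rule Suc)
  finally show ?case by (simp add: mult_ac)
qed simp

lemma lower_power_of_2_mod2:
  "[(lower r ^^ (2 ^ a)) F xs = lower (2 ^ a * r) F xs] (mod 2)"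
proof (induction a arbitrary: r xs)
  case (Suc a)
  have "(lower r ^^ (2 ^ Suc a)) F xs = ((lower r ^^ 2) ^^ 2 ^ a) F xs"
    by (simp add: funpow_mult mult.commute)
  also have "[\<dots> = (lower (2 * r) ^^ 2 ^ a) F xs] (mod 2)"
    by (intro funpow_cong_mod lower_square_cong lower_cong_mod)
  also have "[(lower (2 * r) ^^ 2 ^ a) F xs = lower (2 ^ a * (2 * r)) F xs] (mod 2)" by (rule Suc)
  finally show ?case by (simp add: mult_ac)
qed simp

section \<open>Antisymmetry and vanishing at negative exponents\<close>

definition alternating :: "(int list \<Rightarrow> int) \<Rightarrow> bool" where
  "alternating F \<longleftrightarrow> (\<forall>us x y vs. F (us @ x # y # vs) = - F (us @ y # x # vs))"

lemma alternatingD: "alternating F \<Longrightarrow> F (us @ x # y # vs) = - F (us @ y # x # vs)"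
  unfolding alternating_def by blast

lemma lower_append:
  "lower r F (us @ vs) = lower r (\<lambda>ws. F (ws @ vs)) us + lower r (\<lambda>ws. F (us @ ws)) vs"
  by (induction us arbitrary: F) auto

lemma alternating_lower:
  assumes "alternating F"
  shows "alternating (lower r F)"
  unfolding alternating_def
proof (intro allI)
  fix us x y vs
  have sw: "(\<lambda>ws. F (ws @ x # y # vs)) = (\<lambda>ws. - F (ws @ y # x # vs))"
    "(\<lambda>ws. F (us @ x # y # ws)) = (\<lambda>ws. - F (us @ y # x # ws))"
    by (rule ext, rule alternatingD[OF assms])+
  show "lower r F (us @ x # y # vs) = - lower r F (us @ y # x # vs)"
    using alternatingD[OF assms, of us "x - r" y vs] alternatingD[OF assms, of us x "y - r" vs]
    by (simp add: lower_append sw lower_uminus)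
qed

lemma alternating_funpow_lower: "alternating F \<Longrightarrow> alternating ((lower r ^^ n) F)"
  by (induction n) (auto intro: alternating_lower)

lemma alternating_move:
  assumes "alternating F"
  shows "F (us @ v # ys @ zs) = (- 1) ^ length ys * F (us @ ys @ v # zs)"
proof (induction ys arbitrary: us)
  case (Cons y ys)
  have "F (us @ v # (y # ys) @ zs) = - F ((us @ [y]) @ v # ys @ zs)"
    using alternatingD[OF assms, of us v y "ys @ zs"] by simp
  also have "F ((us @ [y]) @ v # ys @ zs) = (- 1) ^ length ys * F ((us @ [y]) @ ys @ v # zs)"
    by (rule Cons)
  finally show ?case by simp
qed simp

lemma alternating_not_distinct:
  assumes "alternating F" and "\<not> distinct xs"
  shows "F xs = 0"
proof -
  obtain us v ys zs where xs: "xs = us @ [v] @ ys @ [v] @ zs"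
    using not_distinct_decomp[OF assms(2)] by blast
  have "F (us @ ys @ v # v # zs) = 0"
    using alternatingD[OF assms(1), of "us @ ys" v v zs] by simp
  then show ?thesis
    using alternating_move[OF assms(1), of us v ys "v # zs"] xs by simp
qed

lemma lower_conv_sum: "lower r F xs = (\<Sum>i<length xs. F (xs[i := xs ! i - r]))"
  by (induction xs arbitrary: F) (auto simp: sum.lessThan_Suc_shift simp del: sum.lessThan_Suc)

text \<open>Exponents of a polynomial are nonnegative. With integer exponents this has to be carried
  along as a property; it discards the ribbons that would push a bead below 0.\<close>

definition vanishes_neg :: "(int list \<Rightarrow> int) \<Rightarrow> bool" where
  "vanishes_neg F \<longleftrightarrow> (\<forall>xs. (\<exists>x\<in>set xs. x < 0) \<longrightarrow> F xs = 0)"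

lemma vanishes_neg_lower:
  assumes "vanishes_neg F" and "0 \<le> r"
  shows "vanishes_neg (lower r F)"
  unfolding vanishes_neg_def
proof (intro allI impI)
  fix xs :: "int list" assume "\<exists>x\<in>set xs. x < 0"
  then obtain j where j: "j < length xs" "xs ! j < 0" by (auto simp: in_set_conv_nth)
  have "F (xs[i := xs ! i - r]) = 0" if "i < length xs" for i
  proof -
    have "xs[i := xs ! i - r] ! j < 0" using j assms(2) that by (cases "i = j") auto
    then have "\<exists>x\<in>set (xs[i := xs ! i - r]). x < 0"
      using j(1) by (intro bexI[of _ "xs[i := xs ! i - r] ! j"] nth_mem) simp_all
    then show ?thesis using assms(1) unfolding vanishes_neg_def by blast
  qed
  then show "lower r F xs = 0" by (simp add: lower_conv_sum)
qed

lemma vanishes_neg_funpow_lower: "vanishes_neg F \<Longrightarrow> 0 \<le> r \<Longrightarrow> vanishes_neg ((lower r ^^ n) F)"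
  by (induction n) (auto intro: vanishes_neg_lower)

section \<open>The Vandermonde alternant and decreasing exponent lists\<close>

primrec order_sign :: "int list \<Rightarrow> int" where
  "order_sign [] = 1"
| "order_sign (x # xs) = (\<Prod>y\<leftarrow>xs. sgn (x - y)) * order_sign xs"

text \<open>The coefficients of the Vandermonde alternant in \<open>k\<close> variables, normalised
  to 1 at the decreasing exponents \<open>k - 1, ..., 0\<close>. On lists of any other length the
  value is 0: a shorter list cannot have this set of entries, and a longer one repeats an entry,
  which makes \<open>order_sign\<close> vanish.\<close>

definition perm_sign :: "nat \<Rightarrow> int list \<Rightarrow> int" where
  "perm_sign k xs = (if set xs = {0..<int k} then order_sign xs else 0)"

lemma order_sign_swap: "order_sign (us @ x # y # vs) = - order_sign (us @ y # x # vs)"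
proof (induction us)
  case Nil
  show ?case by (cases x y rule: linorder_cases) simp_all
qed simp

lemma alternating_perm_sign: "alternating (perm_sign k)"
  unfolding alternating_def
proof (intro allI)
  fix us vs and x y :: int
  have st: "set (us @ x # y # vs) = set (us @ y # x # vs)" by auto
  show "perm_sign k (us @ x # y # vs) = - perm_sign k (us @ y # x # vs)"
    unfolding perm_sign_def st order_sign_swap[of us x y vs] by simp
qed

lemma vanishes_neg_perm_sign: "vanishes_neg (perm_sign k)"
  unfolding vanishes_neg_def perm_sign_def by auto

lemma order_sign_descending: "sorted_wrt (>) xs \<Longrightarrow> order_sign xs = 1"
proof (induction xs)
  case (Cons x xs)
  have "(\<Prod>y\<leftarrow>xs. sgn (x - y)) = (\<Prod>y\<leftarrow>xs. 1)"
    using Cons.prems by (intro arg_cong[of _ _ prod_list] map_cong) auto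
  also have "\<dots> = 1" by (induction xs) auto
  finally show ?case using Cons by simp
qed simp

text \<open>On distinct entries an alternating function is determined by its values on decreasing
  lists. Beta sets can therefore be handled as sets, with \<open>desc\<close> choosing the list at
  which to evaluate.\<close>

definition desc :: "int set \<Rightarrow> int list" where
  "desc B = rev (sorted_list_of_set B)"

lemma desc_set: "sorted_wrt (>) xs \<Longrightarrow> desc (set xs) = xs"
proof -
  assume s: "sorted_wrt (>) xs"
  have "sorted_wrt (<) (rev xs)" using s by (simp add: sorted_wrt_rev)
  then have "sorted_list_of_set (set (rev xs)) = rev xs"
    by (intro sorted_list_of_set.idem_if_sorted_distinct) (auto simp: strict_sorted_iff)
  then show ?thesis by (simp add: desc_def)
qed

lemma sorted_desc: "finite B \<Longrightarrow> sorted_wrt (>) (desc B)"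
  unfolding desc_def by (simp add: sorted_wrt_rev)

lemma set_desc: "finite B \<Longrightarrow> set (desc B) = B"
  unfolding desc_def by simp

lemma perm_sign_desc:
  "finite B \<Longrightarrow> perm_sign k (desc B) = (if B = {0..<int k} then 1 else 0)"
  by (simp add: perm_sign_def set_desc order_sign_descending sorted_desc)

lemma descending_distinct: "sorted_wrt (>) xs \<Longrightarrow> distinct (xs :: int list)"
  by (induction xs) auto

lemma descending_splitE:
  fixes c :: int
  assumes "sorted_wrt (>) vs" and "c \<notin> set vs"
  obtains ys zs where "vs = ys @ zs" "\<forall>y\<in>set ys. c < y" "\<forall>z\<in>set zs. z < c"
proof -
  have "\<exists>ys zs. vs = ys @ zs \<and> (\<forall>y\<in>set ys. c < y) \<and> (\<forall>z\<in>set zs. z < c)"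
    using assms
  proof (induction vs)
    case (Cons v vs)
    then obtain ys zs where *: "vs = ys @ zs" "\<forall>y\<in>set ys. c < y" "\<forall>z\<in>set zs. z < c"
      by auto
    show ?case
    proof (cases "c < v")
      case True
      then show ?thesis using * by (intro exI[of _ "v # ys"] exI[of _ zs]) simp
    next
      case False
      then show ?thesis
        using Cons.prems by (intro exI[of _ "[]"] exI[of _ "v # vs"]) auto
    qed
  qed simp
  then show ?thesis using that by blast
qed

text \<open>To restore the decreasing order, the lowered entry is carried past the entries strictly
  between \<open>b - r\<close> and \<open>b\<close>, each at the cost of a sign. If
  \<open>b - r\<close> is already present, two entries coincide and \<open>F\<close>
  vanishes.\<close>

lemma alternating_lower_desc_step:
  assumes F: "alternating F" and s: "sorted_wrt (>) (us @ b # vs)" and r: "0 < r"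
    and B: "B = set (us @ b # vs)"
  shows "F (us @ (b - r) # vs) = (if b - r \<in> B then 0
    else (- 1) ^ card {x \<in> B. b - r < x \<and> x < b} * F (desc (insert (b - r) (B - {b}))))"
proof (cases "b - r \<in> B")
  case True
  then have "b - r \<in> set vs \<union> set us" using r unfolding B by auto
  then have "\<not> distinct (us @ (b - r) # vs)" by auto
  then show ?thesis using alternating_not_distinct[OF F] True by simp
next
  case False
  then have "b - r \<notin> set vs" unfolding B by simp
  moreover have vs: "sorted_wrt (>) vs" using s by (simp add: sorted_wrt_append)
  ultimately obtain ys zs where yz: "vs = ys @ zs" "\<forall>y\<in>set ys. b - r < y" "\<forall>z\<in>set zs. z < b - r"
    using descending_splitE by blast
  have us: "\<forall>x\<in>set us. b < x" and ysb: "\<forall>y\<in>set ys. y < b" and zsb: "\<forall>y\<in>set zs. y < b"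
    using s unfolding yz(1) by (simp_all add: sorted_wrt_append)
  have eq: "{x \<in> B. b - r < x \<and> x < b} = set ys"
    unfolding B yz(1) using us ysb yz(2,3) by force
  have "distinct ys"
    using descending_distinct[OF vs] unfolding yz(1) by simp
  then have card: "card {x \<in> B. b - r < x \<and> x < b} = length ys"
    unfolding eq by (rule distinct_card)
  have 1: "sorted_wrt (>) (us @ ys @ (b - r) # zs)"
    using s yz(2,3) us r unfolding yz(1) by (fastforce simp: sorted_wrt_append)
  have "set (us @ ys @ (b - r) # zs) = insert (b - r) (B - {b})"
    unfolding B yz(1) using us ysb zsb by auto
  then have "us @ ys @ (b - r) # zs = desc (insert (b - r) (B - {b}))"
    using desc_set[OF 1] by simp
  then show ?thesis
    using False card alternating_move[OF F, of us "b - r" ys zs] by (simp add: yz(1))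
qed

text \<open>The Murnaghan--Nakayama rule: lowering \<open>b\<close> to \<open>b - r\<close> in a beta set removes a ribbon of
  length \<open>r\<close> whose height is the number of elements passed.\<close>

lemma lower_desc:
  assumes F: "alternating F" and neg: "vanishes_neg F" and B: "finite B" and r: "0 < r"
  shows "lower r F (desc B) = (\<Sum>b \<in> {b \<in> B. r \<le> b \<and> b - r \<notin> B}.
    (- 1) ^ card {x \<in> B. b - r < x \<and> x < b} * F (desc (insert (b - r) (B - {b}))))"
proof -
  let ?g = "\<lambda>b. (- 1) ^ card {x \<in> B. b - r < x \<and> x < b} * F (desc (insert (b - r) (B - {b})))"
  let ?xs = "desc B"
  have s: "sorted_wrt (>) ?xs" by (rule sorted_desc[OF B])
  have d: "distinct ?xs" by (rule descending_distinct[OF s])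
  have "F (?xs[i := ?xs ! i - r]) = (if ?xs ! i - r \<in> B then 0 else ?g (?xs ! i))"
    if i: "i < length ?xs" for i
  proof -
    have xs: "?xs = take i ?xs @ ?xs ! i # drop (Suc i) ?xs" using i by (rule id_take_nth_drop)
    then have "?xs[i := ?xs ! i - r] = take i ?xs @ (?xs ! i - r) # drop (Suc i) ?xs"
      using i by (simp add: upd_conv_take_nth_drop)
    moreover have "sorted_wrt (>) (take i ?xs @ ?xs ! i # drop (Suc i) ?xs)"
      "B = set (take i ?xs @ ?xs ! i # drop (Suc i) ?xs)"
      using s set_desc[OF B] by (simp_all flip: xs)
    ultimately show ?thesis
      using alternating_lower_desc_step[OF F _ r, of "take i ?xs" "?xs ! i" "drop (Suc i) ?xs" B]
      by (simp only:)
  qed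
  then have "lower r F ?xs = (\<Sum>i<length ?xs. if ?xs ! i - r \<in> B then 0 else ?g (?xs ! i))"
    by (simp add: lower_conv_sum)
  also have "\<dots> = (\<Sum>b\<in>set ?xs. if b - r \<in> B then 0 else ?g b)"
    using bij_betw_nth[OF d refl refl] by (rule sum.reindex_bij_betw)
  also have "\<dots> = (\<Sum>b \<in> {b \<in> B. r \<le> b \<and> b - r \<notin> B}. ?g b)"
    unfolding set_desc[OF B]
  proof (rule sum.mono_neutral_cong_right[OF B])
    show "\<forall>b \<in> B - {b \<in> B. r \<le> b \<and> b - r \<notin> B}. (if b - r \<in> B then 0 else ?g b) = 0"
    proof
      fix b assume b: "b \<in> B - {b \<in> B. r \<le> b \<and> b - r \<notin> B}"
      \<comment> \<open>A ribbon longer than \<open>b\<close> would produce a negative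
        exponent.\<close>
      have "F (desc (insert (b - r) (B - {b}))) = 0" if "b < r"
        using neg that B unfolding vanishes_neg_def by (auto simp: set_desc)
      then show "(if b - r \<in> B then 0 else ?g b) = 0" using b by auto
    qed
  qed auto
  finally show ?thesis .
qed

section \<open>Young tableaux and beta sets\<close>

text \<open>The condition \<open>0 < L ! i\<close> matters because shapes will be padded with zero
  rows.\<close>

definition corners :: "nat list \<Rightarrow> nat set" where
  "corners L = {i. i < length L \<and> 0 < L ! i \<and> (Suc i < length L \<longrightarrow> L ! Suc i < L ! i)}"

lemma finite_corners: "finite (corners L)"
  unfolding corners_def by simp

lemma finite_young_cells: "finite (young_cells L)"
proof -
  have "young_cells L = Sigma {..<length L} (\<lambda>i. {..<L ! i})"
    unfolding young_cells_def by auto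
  then show ?thesis by simp
qed

lemma finite_syt: "finite (syt L)"
proof (rule finite_subset)
  show "syt L \<subseteq> {T. \<forall>c. (c \<in> young_cells L \<longrightarrow> T c \<in> {1..sum_list L}) \<and> (c \<notin> young_cells L \<longrightarrow> T c = 0)}"
    unfolding syt_def by (auto simp: bij_betw_def)
  show "finite {T. \<forall>c. (c \<in> young_cells L \<longrightarrow> T c \<in> {1..sum_list L}) \<and> (c \<notin> young_cells L \<longrightarrow> T c = (0::nat))}"
    by (rule finite_set_of_finite_funs) (auto simp: finite_young_cells)
qed

lemma young_cells_remove_corner:
  "i \<in> corners L \<Longrightarrow> young_cells (L[i := L ! i - 1]) = young_cells L - {(i, L ! i - 1)}"
  unfolding corners_def young_cells_def by (auto simp: nth_list_update split: if_splits)

lemma sum_list_remove_corner: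
  "i \<in> corners L \<Longrightarrow> sum_list (L[i := L ! i - 1]) = sum_list L - 1"
  unfolding corners_def using elem_le_sum_list[of i L] by (auto simp: sum_list_update)

text \<open>Erasing the largest entry, which means resetting its cell to the default 0, is inverted
  by writing it back. No cell lies to the right of or below the corner, so no inequality is lost or
  violated.\<close>

lemma card_syt_corner:
  assumes L: "sorted_wrt (\<ge>) L" and i: "i \<in> corners L"
  shows "card {T \<in> syt L. T (i, L ! i - 1) = sum_list L} = f_lam (L[i := L ! i - 1])"
  unfolding f_lam_def
proof (rule bij_betw_same_card)
  let ?c = "(i, L ! i - 1)" and ?C = "young_cells L" and ?L = "L[i := L ! i - 1]"
  let ?N = "sum_list L"
  have c: "?c \<in> ?C" using i unfolding corners_def young_cells_def by auto
  have C': "young_cells ?L = ?C - {?c}" by (rule young_cells_remove_corner[OF i])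
  have N': "sum_list ?L = ?N - 1" by (rule sum_list_remove_corner[OF i])
  have N: "{1..?N} - {?N} = {1..?N - 1}" by auto
  have N0: "0 < ?N" using i elem_le_sum_list[of i L] unfolding corners_def by auto
  have right: "(i, Suc (L ! i - 1)) \<notin> ?C" and below: "(Suc i, L ! i - 1) \<notin> ?C"
    using i unfolding corners_def young_cells_def by auto
  have up: "(a, b) \<in> ?C" if "(Suc a, b) \<in> ?C" for a b
    using that sorted_wrt_nth_less[OF L, of a "Suc a"] unfolding young_cells_def by auto
  have left: "(a, b) \<in> ?C" if "(a, Suc b) \<in> ?C" for a b
    using that unfolding young_cells_def by auto
  show "bij_betw (\<lambda>T. T(?c := 0)) {T \<in> syt L. T ?c = ?N} (syt ?L)"
  proof (rule bij_betw_byWitness[where f' = "\<lambda>T. T(?c := ?N)"])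
    show "\<forall>T \<in> {T \<in> syt L. T ?c = ?N}. (T(?c := 0))(?c := ?N) = T" by auto
    show "\<forall>T \<in> syt ?L. (T(?c := ?N))(?c := 0) = T"
      unfolding syt_def C' by auto
    show "(\<lambda>T. T(?c := 0)) ` {T \<in> syt L. T ?c = ?N} \<subseteq> syt ?L"
    proof
      fix S assume "S \<in> (\<lambda>T. T(?c := 0)) ` {T \<in> syt L. T ?c = ?N}"
      then obtain T where S: "S = T(?c := 0)" and T: "T \<in> syt L" "T ?c = ?N" by auto
      have bij: "bij_betw T ?C {1..?N}"
        and row: "\<And>a b. (a, Suc b) \<in> ?C \<Longrightarrow> T (a, b) < T (a, Suc b)"
        and col: "\<And>a b. (Suc a, b) \<in> ?C \<Longrightarrow> T (a, b) < T (Suc a, b)"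
        and out: "\<And>c. c \<notin> ?C \<Longrightarrow> T c = 0"
        using T(1) unfolding syt_def by auto
      have "bij_betw T (?C - {?c}) ({1..?N} - {?N})"
        using bij c T(2) by (metis bij_betw_DiffI bij_betw_singletonI empty_subsetI insert_subset bij_betw_apply)
      then have "bij_betw S (?C - {?c}) {1..?N - 1}"
        unfolding N S by (subst bij_betw_cong[where g = T]) auto
      moreover have "S (a, b) < S (a, Suc b)" if "(a, Suc b) \<in> ?C - {?c}" for a b
        using row[of a b] that right unfolding S by auto
      moreover have "S (a, b) < S (Suc a, b)" if "(Suc a, b) \<in> ?C - {?c}" for a b
        using col[of a b] that below unfolding S by auto
      ultimately show "S \<in> syt ?L"
        using out unfolding syt_def C' N' by (auto simp: S)
    qed
    show "(\<lambda>T. T(?c := ?N)) ` syt ?L \<subseteq> {T \<in> syt L. T ?c = ?N}"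
    proof
      fix S assume "S \<in> (\<lambda>T. T(?c := ?N)) ` syt ?L"
      then obtain T where S: "S = T(?c := ?N)" and T: "T \<in> syt ?L" by auto
      have bij: "bij_betw T (?C - {?c}) {1..?N - 1}"
        and row: "\<And>a b. (a, Suc b) \<in> ?C - {?c} \<Longrightarrow> T (a, b) < T (a, Suc b)"
        and col: "\<And>a b. (Suc a, b) \<in> ?C - {?c} \<Longrightarrow> T (a, b) < T (Suc a, b)"
        and out: "\<And>c. c \<notin> ?C - {?c} \<Longrightarrow> T c = 0"
        using T unfolding syt_def C' N' by auto
      have less: "T c < ?N" for c
      proof (cases "c \<in> ?C - {?c}")
        case True
        then have "T c \<in> {1..?N - 1}" using bij_betwE[OF bij] by blast
        then have "T c \<le> ?N - 1" by simp
        then show ?thesis using N0 by linarith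
      next
        case False
        then show ?thesis using out[of c] N0 by simp
      qed
      have "bij_betw S (?C - {?c}) {1..?N - 1}"
        using bij unfolding S by (subst bij_betw_cong[where g = T]) auto
      then have "bij_betw S (insert ?c (?C - {?c})) (insert (S ?c) {1..?N - 1})"
        by (subst insert_is_Un, subst (2) insert_is_Un, intro bij_betw_combine)
          (use N0 in \<open>auto simp: bij_betw_def S\<close>)
      moreover have "insert ?c (?C - {?c}) = ?C" "insert (S ?c) {1..?N - 1} = {1..?N}"
        using c N0 by (auto simp: S)
      ultimately have "bij_betw S ?C {1..?N}" by simp
      moreover have "S (a, b) < S (a, Suc b)" if "(a, Suc b) \<in> ?C" for a b
        using row[of a b] that right less[of "(a, b)"] unfolding S by auto
      moreover have "S (a, b) < S (Suc a, b)" if "(Suc a, b) \<in> ?C" for a b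
        using col[of a b] that below less[of "(a, b)"] unfolding S by auto
      ultimately have "S \<in> syt L"
        using out c unfolding syt_def by (auto simp: S)
      then show "S \<in> {T \<in> syt L. T ?c = ?N}" by (simp add: S)
    qed
  qed
qed

text \<open>The tableaux are sorted by the cell of the largest entry. That cell has no neighbour to
  the right or below, hence is the end of a corner row; injectivity of a tableau makes the classes
  disjoint.\<close>

lemma f_lam_branching:
  assumes L: "sorted_wrt (\<ge>) L" and N: "0 < sum_list L"
  shows "f_lam L = (\<Sum>i\<in>corners L. f_lam (L[i := L ! i - 1]))"
proof -
  let ?A = "\<lambda>i. {T \<in> syt L. T (i, L ! i - 1) = sum_list L}"
  have "syt L = (\<Union>i\<in>corners L. ?A i)"
  proof
    show "syt L \<subseteq> (\<Union>i\<in>corners L. ?A i)"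
    proof
      fix T assume T: "T \<in> syt L"
      then have bij: "bij_betw T (young_cells L) {1..sum_list L}" unfolding syt_def by simp
      then obtain i j where c: "(i, j) \<in> young_cells L" "T (i, j) = sum_list L"
        using N unfolding bij_betw_def by (metis atLeastAtMost_iff imageE less_eq_Suc_le One_nat_def order_refl surj_pair)
      have max: "T d \<le> T (i, j)" if "d \<in> young_cells L" for d
        using bij_betwE[OF bij] that c by auto
      have row: "(i, Suc j) \<in> young_cells L \<Longrightarrow> T (i, j) < T (i, Suc j)"
        and col: "(Suc i, j) \<in> young_cells L \<Longrightarrow> T (i, j) < T (Suc i, j)"
        using T unfolding syt_def by auto
      have right: "(i, Suc j) \<notin> young_cells L" using row max[of "(i, Suc j)"] by fastforce
      have below: "(Suc i, j) \<notin> young_cells L" using col max[of "(Suc i, j)"] by fastforce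
      have "j = L ! i - 1" "i \<in> corners L"
        using c(1) right below unfolding young_cells_def corners_def by auto
      then show "T \<in> (\<Union>i\<in>corners L. ?A i)" using T c by auto
    qed
  qed auto
  moreover have "card (\<Union>i\<in>corners L. ?A i) = (\<Sum>i\<in>corners L. card (?A i))"
  proof (rule card_UN_disjoint[OF finite_corners])
    show "\<forall>i\<in>corners L. finite (?A i)" using finite_syt by simp
    have "i = j" if ij: "i \<in> corners L" "j \<in> corners L" and T: "T \<in> ?A i" "T \<in> ?A j" for i j T
    proof -
      have "inj_on T (young_cells L)" using T unfolding syt_def bij_betw_def by simp
      moreover have "(i, L ! i - 1) \<in> young_cells L" "(j, L ! j - 1) \<in> young_cells L"
        using ij unfolding corners_def young_cells_def by auto
      ultimately have "(i, L ! i - 1) = (j, L ! j - 1)"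
        using T by (intro inj_onD[of T "young_cells L" "(i, L ! i - 1)" "(j, L ! j - 1)"]) simp_all
      then show ?thesis by simp
    qed
    then show "\<forall>i\<in>corners L. \<forall>j\<in>corners L. i \<noteq> j \<longrightarrow> ?A i \<inter> ?A j = {}" by blast
  qed
  ultimately show ?thesis
    unfolding f_lam_def[of L] using card_syt_corner[OF L] by simp
qed

lemma f_lam_zero:
  assumes "sum_list L = 0"
  shows "f_lam L = 1"
proof -
  have "L ! i = 0" if "i < length L" for i using assms nth_mem[OF that] by simp
  then have "young_cells L = {}" unfolding young_cells_def by simp
  then have "syt L = {\<lambda>_. 0}" using assms unfolding syt_def by (auto simp: fun_eq_iff bij_betw_def)
  then show ?thesis unfolding f_lam_def by simp
qed

lemma f_lam_append_zeros: "f_lam (L @ replicate m 0) = f_lam L"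
proof -
  have "young_cells (L @ replicate m 0) = young_cells L"
    unfolding young_cells_def by (auto simp: nth_append split: if_splits)
  then show ?thesis unfolding f_lam_def syt_def by (simp add: sum_list_replicate)
qed

text \<open>Adding the staircase turns a weakly decreasing list into a strictly decreasing one. If
  all parts are positive, the entries are the hook lengths of the first column.\<close>

primrec beta :: "nat list \<Rightarrow> int list" where
  "beta [] = []"
| "beta (x # xs) = (int x + int (length xs)) # beta xs"

lemma length_beta [simp]: "length (beta L) = length L"
  by (induction L) auto

lemma nth_beta: "i < length L \<Longrightarrow> beta L ! i = int (L ! i) + int (length L - Suc i)"
  by (induction L arbitrary: i) (auto simp: nth_Cons split: nat.splits)

lemma sorted_beta:
  assumes "sorted_wrt (\<ge>) L"
  shows "sorted_wrt (>) (beta L)"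
  unfolding sorted_wrt_iff_nth_less
proof (intro allI impI)
  fix i j assume "i < j" "j < length (beta L)"
  then show "beta L ! j < beta L ! i"
    using sorted_wrt_nth_less[OF assms, of i j] by (simp add: nth_beta)
qed

lemma set_beta_zero: "set (beta (replicate k 0)) = {0..<int k}"
  by (induction k) auto

text \<open>Both sides obey the branching rule, as lowering entry \<open>i\<close> by 1 removes a
  cell from row \<open>i\<close>. For a row that is not a corner the lowered list repeats an entry
  (two equal rows) or has a negative one (a last row equal to 0), so its coefficient is 0. At the
  empty shape the coefficient is the leading one of the alternant.\<close>

lemma f_lam_beta:
  assumes "sorted_wrt (\<ge>) L" and "length L = k"
  shows "int (f_lam L) = (lower 1 ^^ sum_list L) (perm_sign k) (beta L)"
  using assms
proof (induction "sum_list L" arbitrary: L)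
  case 0
  have "L = replicate k 0"
    using 0 by (metis replicate_length_same sum_list_eq_0_iff)
  then have "set (beta L) = {0..<int k}" by (simp add: set_beta_zero)
  then show ?case
    using 0 f_lam_zero[of L] order_sign_descending[OF sorted_beta[of L]] by (simp add: perm_sign_def flip: 0(1))
next
  case (Suc m)
  let ?F = "(lower 1 ^^ m) (perm_sign k)"
  have alt: "alternating ?F" by (intro alternating_funpow_lower alternating_perm_sign)
  have neg: "vanishes_neg ?F" by (intro vanishes_neg_funpow_lower vanishes_neg_perm_sign) simp
  have corner: "?F ((beta L)[i := beta L ! i - 1]) = int (f_lam (L[i := L ! i - 1]))" if i: "i \<in> corners L" for i
  proof -
    have i': "i < length L" "0 < L ! i" using i unfolding corners_def by auto
    have "(beta L)[i := beta L ! i - 1] = beta (L[i := L ! i - 1])"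
      using i' by (intro nth_equalityI) (auto simp: nth_list_update nth_beta)
    moreover have "sorted_wrt (\<ge>) (L[i := L ! i - 1])"
      unfolding sorted_wrt_iff_nth_less
    proof (intro allI impI)
      fix a b assume ab: "a < b" "b < length (L[i := L ! i - 1])"
      have 1: "L ! b \<le> L ! a" using sorted_wrt_nth_less[OF Suc.prems(1), of a b] ab by simp
      have "L ! b \<le> L ! Suc i" if "a = i"
        using sorted_wrt_nth_less[OF Suc.prems(1), of "Suc i" b] ab that by (cases "b = Suc i") auto
      then have "L ! b < L ! i" if "a = i" using i ab that unfolding corners_def by fastforce
      then show "L[i := L ! i - 1] ! b \<le> L[i := L ! i - 1] ! a"
        using 1 ab i' by (cases "a = i"; cases "b = i") (auto simp: nth_list_update)
    qed
    moreover have "sum_list (L[i := L ! i - 1]) = m"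
      using sum_list_remove_corner[OF i] Suc.hyps(2) by simp
    ultimately show ?thesis using Suc.hyps(1)[of "L[i := L ! i - 1]"] Suc.prems(2) by simp
  qed
  have no_corner: "?F ((beta L)[i := beta L ! i - 1]) = 0" if i: "i < length L" "i \<notin> corners L" for i
  proof (cases "Suc i < length L")
    case True
    have "L ! Suc i = L ! i"
      using i True sorted_wrt_nth_less[OF Suc.prems(1), of i "Suc i"] unfolding corners_def by auto
    then have "(beta L)[i := beta L ! i - 1] ! i = (beta L)[i := beta L ! i - 1] ! Suc i"
      using True by (simp add: nth_beta)
    then have "\<not> distinct ((beta L)[i := beta L ! i - 1])"
      using True by (metis Suc_lessD length_beta length_list_update n_not_Suc_n nth_eq_iff_index_eq)
    then show ?thesis by (rule alternating_not_distinct[OF alt])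
  next
    case False
    then have "L ! i = 0" "length L = Suc i" using i unfolding corners_def by auto
    then have "(beta L)[i := beta L ! i - 1] ! i < 0" using i by (simp add: nth_beta)
    then have "\<exists>x \<in> set ((beta L)[i := beta L ! i - 1]). x < 0"
      using i(1) by (metis length_beta length_list_update nth_mem)
    then show ?thesis using neg unfolding vanishes_neg_def by blast
  qed
  have "(lower 1 ^^ sum_list L) (perm_sign k) (beta L) = lower 1 ?F (beta L)"
    by (simp flip: Suc.hyps(2))
  also have "\<dots> = (\<Sum>i<length L. ?F ((beta L)[i := beta L ! i - 1]))"
    by (simp add: lower_conv_sum)
  also have "\<dots> = (\<Sum>i\<in>corners L. int (f_lam (L[i := L ! i - 1])))"
    by (rule sum.mono_neutral_cong_right) (auto simp: corner no_corner corners_def[of L])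
  also have "\<dots> = int (f_lam L)"
    using f_lam_branching[OF Suc.prems(1)] by (simp flip: Suc.hyps(2))
  finally show ?case by simp
qed

section \<open>Bead sets of partitions\<close>

text \<open>The beta sets of the partitions of \<open>n\<close>, all taken with \<open>n\<close>
  beads. This suffices since there are at most \<open>n\<close> parts, and for
  \<open>n = 3 M\<close> the empty partition then fills three complete rows of the abacus with
  \<open>M\<close> runners.\<close>

definition bead_sets :: "nat \<Rightarrow> int set set" where
  "bead_sets n = {B. finite B \<and> card B = n \<and> (\<forall>b\<in>B. 0 \<le> b) \<and> \<Sum>B = int n + \<Sum>{0..<int n}}"

definition padded :: "nat \<Rightarrow> nat list \<Rightarrow> nat list" where
  "padded n lam = lam @ replicate (n - length lam) 0"

definition beads :: "nat \<Rightarrow> nat list \<Rightarrow> int set" where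
  "beads n lam = set (beta (padded n lam))"

definition bead_f :: "nat \<Rightarrow> int set \<Rightarrow> int" where
  "bead_f n B = (lower 1 ^^ n) (perm_sign n) (desc B)"

lemma length_le_partition:
  assumes "lam \<in> partitions n"
  shows "length lam \<le> n"
proof -
  have "\<forall>x\<in>set lam. 0 < x \<Longrightarrow> length lam \<le> sum_list lam"
    by (induction lam) auto
  then show ?thesis using assms unfolding partitions_def by auto
qed

lemma padded_partition:
  assumes "lam \<in> partitions n"
  shows "length (padded n lam) = n" "sorted_wrt (\<ge>) (padded n lam)" "sum_list (padded n lam) = n"
    "filter (\<lambda>x. 0 < x) (padded n lam) = lam"
proof -
  show "length (padded n lam) = n"
    using length_le_partition[OF assms] by (simp add: padded_def)
  show "sum_list (padded n lam) = n"
    using assms by (simp add: padded_def partitions_def sum_list_replicate)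
  have "sorted_wrt (\<ge>) (replicate m (0 :: nat))" for m by (induction m) auto
  then show "sorted_wrt (\<ge>) (padded n lam)"
    using assms by (simp add: padded_def partitions_def sorted_wrt_append)
  show "filter (\<lambda>x. 0 < x) (padded n lam) = lam"
    using assms by (simp add: padded_def partitions_def filter_id_conv)
qed

lemma desc_beads: "lam \<in> partitions n \<Longrightarrow> desc (beads n lam) = beta (padded n lam)"
  unfolding beads_def by (rule desc_set[OF sorted_beta[OF padded_partition(2)]])

lemma bead_f_beads:
  assumes "lam \<in> partitions n"
  shows "bead_f n (beads n lam) = int (f_lam lam)"
proof -
  note p = padded_partition[OF assms]
  have "int (f_lam (padded n lam)) = (lower 1 ^^ n) (perm_sign n) (beta (padded n lam))"
    using f_lam_beta[OF p(2,1)] p(3) by simp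
  moreover have "f_lam (padded n lam) = f_lam lam"
    unfolding padded_def by (rule f_lam_append_zeros)
  ultimately show ?thesis unfolding bead_f_def desc_beads[OF assms] by simp
qed

lemma beta_inject: "length L = length L' \<Longrightarrow> beta L = beta L' \<Longrightarrow> L = L'"
  by (induction L L' rule: list_induct2) auto

lemma sum_list_beta: "sum_list (beta L) = int (sum_list L) + \<Sum>{0..<int (length L)}"
proof (induction L)
  case (Cons x L)
  have "{0..<int (length (x # L))} = insert (int (length L)) {0..<int (length L)}" by auto
  then show ?case using Cons by simp
qed simp

lemma beta_surj:
  assumes "sorted_wrt (>) xs" and "\<forall>x\<in>set xs. 0 \<le> x"
  obtains L where "sorted_wrt (\<ge>) L" "beta L = xs"
proof -
  have "\<exists>L. sorted_wrt (\<ge>) L \<and> beta L = xs" using assms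
  proof (induction xs)
    case (Cons x xs)
    then obtain L where L: "sorted_wrt (\<ge>) L" "beta L = xs" by auto
    have len: "length L = length xs" using L(2) length_beta[of L] by simp
    \<comment> \<open>An entry of \<open>L\<close> is at most the head of \<open>L\<close>; the
      strict descent from \<open>x\<close> to the head of \<open>xs\<close> supplies the extra 1 of
      the staircase.\<close>
    have ge: "int y + int (length L) \<le> x" if y: "y \<in> set L" for y
    proof -
      obtain z L' where L': "L = z # L'" using y by (cases L) auto
      have "y \<le> z" using y L(1) L' by auto
      moreover have "int z + int (length L') < x" using Cons.prems(1) L' L(2) by auto
      ultimately show ?thesis by (simp add: L')
    qed
    have "int (length L) \<le> x"
    proof (cases L)
      case Nil
      then show ?thesis using Cons.prems(2) by simp
    next
      case (Cons z L')
      then show ?thesis using ge[of z] by simp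
    qed
    then have "beta (nat (x - int (length L)) # L) = x # xs" using L(2) by simp
    moreover have "sorted_wrt (\<ge>) (nat (x - int (length L)) # L)"
      using ge L(1) by fastforce
    ultimately show ?case by blast
  qed (auto intro: exI[of _ "[]"])
  then show ?thesis using that by blast
qed

lemma sum_list_filter_pos: "sum_list (filter (\<lambda>x. 0 < x) L) = sum_list (L :: nat list)"
  by (induction L) auto

lemma sorted_nat_split_zeros:
  "sorted_wrt (\<ge>) (L :: nat list) \<Longrightarrow>
    filter (\<lambda>x. 0 < x) L @ replicate (length L - length (filter (\<lambda>x. 0 < x) L)) 0 = L"
proof (induction L)
  case (Cons x L)
  show ?case
  proof (cases "0 < x")
    case True
    have "sorted_wrt (\<ge>) L" using Cons.prems by simp
    note IH = Cons.IH[OF this]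
    have "filter (\<lambda>y. 0 < y) (x # L) = x # filter (\<lambda>y. 0 < y) L" using True by simp
    then show ?thesis using IH by (simp only: list.size append_Cons add_Suc_right add_0_right diff_Suc_Suc)
  next
    case False
    have all: "\<forall>y\<in>set (x # L). y = 0" using False Cons.prems by auto
    have "replicate (length (x # L)) 0 = x # L" using all by (intro replicate_length_same)
    moreover have "filter (\<lambda>y. 0 < y) (x # L) = []" unfolding filter_empty_conv using all by auto
    ultimately show ?thesis by (simp only: append_Nil list.size diff_zero)
  qed
qed simp

text \<open>The preimage of a bead set is found by listing it in decreasing order, subtracting the
  staircase and dropping zero parts. The prescribed sum says exactly that the parts add up to
  \<open>n\<close>.\<close>

lemma bij_betw_beads: "bij_betw (beads n) (partitions n) (bead_sets n)"
  unfolding bij_betw_def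
proof
  show "inj_on (beads n) (partitions n)"
  proof (rule inj_onI)
    fix lam mu assume lm: "lam \<in> partitions n" "mu \<in> partitions n" "beads n lam = beads n mu"
    note p = padded_partition[OF lm(1)] and q = padded_partition[OF lm(2)]
    have "beta (padded n lam) = beta (padded n mu)"
      using desc_beads[OF lm(1)] desc_beads[OF lm(2)] lm(3) by argo
    then have "padded n lam = padded n mu" using p(1) q(1) by (intro beta_inject) simp_all
    then show "lam = mu" using p(4) q(4) by argo
  qed
  show "beads n ` partitions n = bead_sets n"
  proof
    show "beads n ` partitions n \<subseteq> bead_sets n"
    proof
      fix B assume "B \<in> beads n ` partitions n"
      then obtain lam where lam: "lam \<in> partitions n" and B: "B = beads n lam" by auto
      note p = padded_partition[OF lam]
      have d: "distinct (beta (padded n lam))" by (rule descending_distinct[OF sorted_beta[OF p(2)]])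
      have "0 \<le> b" if b: "b \<in> set (beta L)" for b L using b by (induction L) auto
      moreover have "\<Sum>B = sum_list (beta (padded n lam))"
        unfolding B beads_def using d by (simp add: distinct_sum_list_conv_Sum)
      ultimately show "B \<in> bead_sets n"
        unfolding bead_sets_def B beads_def
        using distinct_card[OF d] p(1,3) sum_list_beta[of "padded n lam"] by (simp add: beads_def)
    qed
    show "bead_sets n \<subseteq> beads n ` partitions n"
    proof
      fix B assume "B \<in> bead_sets n"
      then have B: "finite B" "card B = n" "\<forall>b\<in>B. 0 \<le> b" "\<Sum>B = int n + \<Sum>{0..<int n}"
        unfolding bead_sets_def by auto
      obtain L where L: "sorted_wrt (\<ge>) L" "beta L = desc B"
        using beta_surj[OF sorted_desc[OF B(1)]] B(3) set_desc[OF B(1)] by auto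
      have d: "distinct (desc B)" by (rule descending_distinct[OF sorted_desc[OF B(1)]])
      have len: "length L = n"
        using distinct_card[OF d] B(2) set_desc[OF B(1)] length_beta[of L] L(2) by simp
      have "sum_list (beta L) = \<Sum>B"
        unfolding L(2) using distinct_sum_list_conv_Sum[OF d] set_desc[OF B(1)] by simp
      then have sum: "sum_list L = n" using sum_list_beta[of L] B(4) len by simp
      let ?lam = "filter (\<lambda>x. 0 < x) L"
      have "?lam \<in> partitions n"
        unfolding partitions_def using L(1) sum by (simp add: sum_list_filter_pos sorted_wrt_filter)
      moreover have "padded n ?lam = L"
        using sorted_nat_split_zeros[OF L(1)] len unfolding padded_def by simp
      then have "beads n ?lam = B"
        unfolding beads_def using L(2) set_desc[OF B(1)] by simp
      ultimately show "B \<in> beads n ` partitions n" by blast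
    qed
  qed
qed

lemma finite_partitions: "finite (partitions n)"
proof (rule finite_subset)
  show "partitions n \<subseteq> {lam. set lam \<subseteq> {..n} \<and> length lam \<le> n}"
    using length_le_partition member_le_sum_list by (fastforce simp: partitions_def)
  show "finite {lam. set lam \<subseteq> {..n} \<and> length lam \<le> n}"
    by (rule finite_lists_length_le) simp
qed

lemma finite_bead_sets: "finite (bead_sets n)"
  using bij_betw_finite[OF bij_betw_beads] finite_partitions by blast

lemma a_cnt_bead_sets:
  "a_cnt i n = card {B \<in> bead_sets n. bead_f n B mod 4 = int i}"
proof -
  have "bij_betw (beads n) {lam \<in> partitions n. f_lam lam mod 4 = i}
    {B \<in> bead_sets n. bead_f n B mod 4 = int i}"
  proof (rule bij_betw_subset[OF bij_betw_beads])
    have iff: "bead_f n (beads n lam) mod 4 = int i \<longleftrightarrow> f_lam lam mod 4 = i" if "lam \<in> partitions n" for lam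
      unfolding bead_f_beads[OF that] by (metis of_nat_eq_iff of_nat_mod of_nat_numeral)
    have "{B \<in> bead_sets n. bead_f n B mod 4 = int i}
        = {B \<in> beads n ` partitions n. bead_f n B mod 4 = int i}"
      unfolding bij_betw_imp_surj_on[OF bij_betw_beads] by (rule refl)
    also have "\<dots> = beads n ` {lam \<in> partitions n. f_lam lam mod 4 = i}"
      using iff by auto
    finally show "beads n ` {lam \<in> partitions n. f_lam lam mod 4 = i} = {B \<in> bead_sets n. bead_f n B mod 4 = int i}"
      by (rule sym)
  qed auto
  then show ?thesis unfolding a_cnt_def by (rule bij_betw_same_card)
qed

section \<open>Configurations with few moved beads\<close>

definition moved :: "int \<Rightarrow> int \<Rightarrow> int set \<Rightarrow> int set" where
  "moved a b B = insert b (B - {a})"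

lemma finite_moved [simp]: "finite (moved a b B) \<longleftrightarrow> finite B"
  by (simp add: moved_def)

text \<open>\<open>(-1)^k\<close> for integer \<open>k\<close>, so that exponents such as
  \<open>M - 1 - i\<close> need no truncated subtraction.\<close>

definition parity_sign :: "int \<Rightarrow> int" where
  "parity_sign k = (if even k then 1 else - 1)"

definition admissible :: "(int list \<Rightarrow> int) \<Rightarrow> bool" where
  "admissible F \<longleftrightarrow> alternating F \<and> vanishes_neg F"

lemma admissible_lower: "admissible F \<Longrightarrow> 0 \<le> r \<Longrightarrow> admissible (lower r F)"
  by (simp add: admissible_def alternating_lower vanishes_neg_lower)

lemma admissible_funpow_lower: "admissible F \<Longrightarrow> 0 \<le> r \<Longrightarrow> admissible ((lower r ^^ n) F)"
  by (induction n) (auto intro: admissible_lower)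

lemma admissible_perm_sign: "admissible (perm_sign n)"
  by (simp add: admissible_def alternating_perm_sign vanishes_neg_perm_sign)

text \<open>The leg length of the ribbon removed by moving \<open>b\<close> to
  \<open>b - r\<close>.\<close>

definition passed :: "int \<Rightarrow> int set \<Rightarrow> int \<Rightarrow> int" where
  "passed r B b = int (card {x \<in> B. b - r < x \<and> x < b})"

lemma lower_desc_sum:
  assumes "admissible F" "finite B" "0 < r" "{b \<in> B. r \<le> b \<and> b - r \<notin> B} = S"
  shows "lower r F (desc B) = (\<Sum>b\<in>S. parity_sign (passed r B b) * F (desc (moved b (b - r) B)))"
  using lower_desc[of F B r] assms
  by (simp add: admissible_def passed_def parity_sign_def moved_def minus_one_power_iff)

lemma lower_desc_single:
  assumes "admissible F" "finite B" "0 < r" "{b \<in> B. r \<le> b \<and> b - r \<notin> B} = {a}"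
    and "moved a (a - r) B = C"
  shows "lower r F (desc B) = parity_sign (passed r B a) * F (desc C)"
  using lower_desc_sum[OF assms(1-4)] assms(5) by simp

lemma lower_desc_pair:
  assumes "admissible F" "finite B" "0 < r" "{b \<in> B. r \<le> b \<and> b - r \<notin> B} = {a, a'}" "a \<noteq> a'"
    and "moved a (a - r) B = C" "moved a' (a' - r) B = C'"
  shows "lower r F (desc B) = parity_sign (passed r B a) * F (desc C) + parity_sign (passed r B a') * F (desc C')"
  using lower_desc_sum[OF assms(1-4)] assms(5-7) by simp

context
  fixes M :: int
begin

text \<open>Bead \<open>c M + i\<close> with \<open>0 \<le> i < M\<close> sits in row \<open>c\<close> of runner \<open>i\<close>. The suffixed names describe the
  \<open>M\<close>-quotient: \<open>row2\<close> is \<open>(2)\<close> on runner \<open>i\<close>, \<open>col2\<close> is \<open>(1,1)\<close>, \<open>mid3\<close> is \<open>(2,1)\<close>, and a trailing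
  \<open>hook\<close> is a further \<open>(1)\<close> on runner \<open>j\<close>.\<close>

definition "ground = {0..<3 * M}"
definition "hook i = moved (2 * M + i) (3 * M + i) ground"
definition "row2 i = moved (2 * M + i) (4 * M + i) ground"
definition "col2 i = moved (M + i) (3 * M + i) ground"
definition "hooks2 i j = moved (2 * M + j) (3 * M + j) (hook i)"
definition "row3 i = moved (2 * M + i) (5 * M + i) ground"
definition "col3 i = moved i (3 * M + i) ground"
definition "mid3 i = moved (M + i) (4 * M + i) ground"
definition "row2_hook i j = moved (2 * M + j) (3 * M + j) (row2 i)"
definition "col2_hook i j = moved (2 * M + j) (3 * M + j) (col2 i)"
definition "hooks3 i j l = moved (2 * M + l) (3 * M + l) (hooks2 i j)"

lemmas config_defs = ground_def hook_def row2_def col2_def hooks2_def row3_def col3_def mid3_def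
  row2_hook_def col2_hook_def hooks3_def

lemma finite_config [simp]: "finite ground" "finite (hook i)" "finite (row2 i)" "finite (col2 i)"
  "finite (hooks2 i j)" "finite (row3 i)" "finite (col3 i)" "finite (mid3 i)"
  "finite (row2_hook i j)" "finite (col2_hook i j)" "finite (hooks3 i j l)"
  by (simp_all add: config_defs)

section \<open>Removing ribbons of length M from the configurations\<close>

context
  fixes F i
  assumes F: "admissible F" and i: "0 \<le> i" "i < M"
begin

text \<open>The movable beads are the removable cells of the quotient; here there is one. It jumps
  over the beads of row 2 on the runners after \<open>i\<close>. The lemmas below follow the same
  scheme.\<close>

lemma lower_hook: "lower M F (desc (hook i)) = parity_sign (M - 1 - i) * F (desc (ground))"
proof -
  have "{x \<in> hook i. 3 * M + i - M < x \<and> x < 3 * M + i} = {2 * M + i<..<3 * M}"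
    using i unfolding config_defs moved_def by auto
  then have p: "passed M (hook i) (3 * M + i) = M - 1 - i" using i by (simp add: passed_def)
  have "{b \<in> hook i. M \<le> b \<and> b - M \<notin> hook i} = {3 * M + i}"
    using i unfolding config_defs moved_def by auto
  moreover have "moved (3 * M + i) (3 * M + i - M) (hook i) = ground"
    using i unfolding config_defs moved_def by auto
  ultimately have "lower M F (desc (hook i)) = parity_sign (passed M (hook i) (3 * M + i)) * F (desc (ground))"
    using i by (intro lower_desc_single[OF F]) simp_all
  then show ?thesis unfolding p by (simp add: parity_sign_def)
qed

lemma lower_row2: "lower M F (desc (row2 i)) = 1 * F (desc (hook i))"
proof -
  have "{x \<in> row2 i. 4 * M + i - M < x \<and> x < 4 * M + i} = {}"
    using i unfolding config_defs moved_def by auto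
  then have p: "passed M (row2 i) (4 * M + i) = 0" using i by (simp add: passed_def)
  have "{b \<in> row2 i. M \<le> b \<and> b - M \<notin> row2 i} = {4 * M + i}"
    using i unfolding config_defs moved_def by auto
  moreover have "moved (4 * M + i) (4 * M + i - M) (row2 i) = hook i"
    using i unfolding config_defs moved_def by auto
  ultimately have "lower M F (desc (row2 i)) = parity_sign (passed M (row2 i) (4 * M + i)) * F (desc (hook i))"
    using i by (intro lower_desc_single[OF F]) simp_all
  then show ?thesis unfolding p by (simp add: parity_sign_def)
qed

lemma lower_col2: "lower M F (desc (col2 i)) = parity_sign (M - 1) * F (desc (hook i))"
proof -
  have "{x \<in> col2 i. 2 * M + i - M < x \<and> x < 2 * M + i} = {M + i<..<2 * M + i}"
    using i unfolding config_defs moved_def by auto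
  then have p: "passed M (col2 i) (2 * M + i) = M - 1" using i by (simp add: passed_def)
  have "{b \<in> col2 i. M \<le> b \<and> b - M \<notin> col2 i} = {2 * M + i}"
    using i unfolding config_defs moved_def by auto
  moreover have "moved (2 * M + i) (2 * M + i - M) (col2 i) = hook i"
    using i unfolding config_defs moved_def by auto
  ultimately have "lower M F (desc (col2 i)) = parity_sign (passed M (col2 i) (2 * M + i)) * F (desc (hook i))"
    using i by (intro lower_desc_single[OF F]) simp_all
  then show ?thesis unfolding p by (simp add: parity_sign_def)
qed

lemma lower_row3: "lower M F (desc (row3 i)) = 1 * F (desc (row2 i))"
proof -
  have "{x \<in> row3 i. 5 * M + i - M < x \<and> x < 5 * M + i} = {}"
    using i unfolding config_defs moved_def by auto
  then have p: "passed M (row3 i) (5 * M + i) = 0" using i by (simp add: passed_def)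
  have "{b \<in> row3 i. M \<le> b \<and> b - M \<notin> row3 i} = {5 * M + i}"
    using i unfolding config_defs moved_def by auto
  moreover have "moved (5 * M + i) (5 * M + i - M) (row3 i) = row2 i"
    using i unfolding config_defs moved_def by auto
  ultimately have "lower M F (desc (row3 i)) = parity_sign (passed M (row3 i) (5 * M + i)) * F (desc (row2 i))"
    using i by (intro lower_desc_single[OF F]) simp_all
  then show ?thesis unfolding p by (simp add: parity_sign_def)
qed

lemma lower_col3: "lower M F (desc (col3 i)) = parity_sign (M - 1) * F (desc (col2 i))"
proof -
  have "{x \<in> col3 i. M + i - M < x \<and> x < M + i} = {i<..<M + i}"
    using i unfolding config_defs moved_def by auto
  then have p: "passed M (col3 i) (M + i) = M - 1" using i by (simp add: passed_def)
  have "{b \<in> col3 i. M \<le> b \<and> b - M \<notin> col3 i} = {M + i}"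
    using i unfolding config_defs moved_def by auto
  moreover have "moved (M + i) (M + i - M) (col3 i) = col2 i"
    using i unfolding config_defs moved_def by auto
  ultimately have "lower M F (desc (col3 i)) = parity_sign (passed M (col3 i) (M + i)) * F (desc (col2 i))"
    using i by (intro lower_desc_single[OF F]) simp_all
  then show ?thesis unfolding p by (simp add: parity_sign_def)
qed

text \<open>The quotient \<open>(2,1)\<close> has two removable cells, hence two summands.\<close>

lemma lower_mid3: "lower M F (desc (mid3 i)) =
    1 * F (desc (col2 i)) + parity_sign (M - 1) * F (desc (row2 i))"
proof -
  have pa: "parity_sign (passed M (mid3 i) (4 * M + i)) = 1"
  proof -
    have "{x \<in> mid3 i. 4 * M + i - M < x \<and> x < 4 * M + i} = {}"
      using i unfolding config_defs moved_def by auto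
    then have "passed M (mid3 i) (4 * M + i) = 0" by (simp only: passed_def card.empty of_nat_0)
    then show ?thesis using i by (simp add: parity_sign_def)
  qed
  have pb: "parity_sign (passed M (mid3 i) (2 * M + i)) = parity_sign (M - 1)"
  proof -
    have "{x \<in> mid3 i. 2 * M + i - M < x \<and> x < 2 * M + i} = {M + i<..<2 * M + i}"
      using i unfolding config_defs moved_def by auto
    then show ?thesis using i by (simp add: passed_def parity_sign_def)
  qed
  have "{b \<in> mid3 i. M \<le> b \<and> b - M \<notin> mid3 i} = {4 * M + i, 2 * M + i}"
    using i unfolding config_defs moved_def by auto
  moreover have "moved (4 * M + i) (4 * M + i - M) (mid3 i) = col2 i"
    using i unfolding config_defs moved_def by auto
  moreover have "moved (2 * M + i) (2 * M + i - M) (mid3 i) = row2 i"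
    using i unfolding config_defs moved_def by auto
  ultimately have "lower M F (desc (mid3 i)) = parity_sign (passed M (mid3 i) (4 * M + i)) * F (desc (col2 i))
      + parity_sign (passed M (mid3 i) (2 * M + i)) * F (desc (row2 i))"
    using i by (intro lower_desc_pair[OF F]) simp_all
  then show ?thesis unfolding pa pb by simp
qed

context
  fixes j
  assumes j: "0 \<le> j" "j < M" and ij: "i \<noteq> j"
begin

text \<open>Compared with a single hook, the interval jumped over either misses the bead
  \<open>2 * M + j\<close> or gains the bead \<open>3 * M + j\<close>, depending on the order of
  \<open>i\<close> and \<open>j\<close>. Both change the count by one, so the sign does not depend
  on the order.\<close>

lemma lower_hooks2: "lower M F (desc (hooks2 i j)) =
    parity_sign (M + i) * F (desc (hook j)) + parity_sign (M + j) * F (desc (hook i))"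
proof -
  have pa: "parity_sign (passed M (hooks2 i j) (3 * M + i)) = parity_sign (M + i)"
  proof (cases "i < j")
    case True
    then have "{x \<in> hooks2 i j. 3 * M + i - M < x \<and> x < 3 * M + i} = {2 * M + i<..<3 * M} - {2 * M + j}"
      using i j ij unfolding config_defs moved_def by auto
    then show ?thesis using i j ij True by (simp add: passed_def parity_sign_def)
  next
    case False
    then have "{x \<in> hooks2 i j. 3 * M + i - M < x \<and> x < 3 * M + i} = insert (3 * M + j) {2 * M + i<..<3 * M}"
      using i j ij unfolding config_defs moved_def by auto
    then show ?thesis using i j ij False by (simp add: passed_def parity_sign_def)
  qed
  have pb: "parity_sign (passed M (hooks2 i j) (3 * M + j)) = parity_sign (M + j)"
  proof (cases "i < j")
    case True
    then have "{x \<in> hooks2 i j. 3 * M + j - M < x \<and> x < 3 * M + j} = insert (3 * M + i) {2 * M + j<..<3 * M}"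
      using i j ij unfolding config_defs moved_def by auto
    then show ?thesis using i j ij True by (simp add: passed_def parity_sign_def)
  next
    case False
    then have "{x \<in> hooks2 i j. 3 * M + j - M < x \<and> x < 3 * M + j} = {2 * M + j<..<3 * M} - {2 * M + i}"
      using i j ij unfolding config_defs moved_def by auto
    then show ?thesis using i j ij False by (simp add: passed_def parity_sign_def)
  qed
  have "{b \<in> hooks2 i j. M \<le> b \<and> b - M \<notin> hooks2 i j} = {3 * M + i, 3 * M + j}"
    using i j ij unfolding config_defs moved_def by auto
  moreover have "moved (3 * M + i) (3 * M + i - M) (hooks2 i j) = hook j"
    using i j ij unfolding config_defs moved_def by auto
  moreover have "moved (3 * M + j) (3 * M + j - M) (hooks2 i j) = hook i"
    using i j ij unfolding config_defs moved_def by auto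
  ultimately have "lower M F (desc (hooks2 i j)) = parity_sign (passed M (hooks2 i j) (3 * M + i)) * F (desc (hook j))
      + parity_sign (passed M (hooks2 i j) (3 * M + j)) * F (desc (hook i))"
    using i j ij by (intro lower_desc_pair[OF F]) simp_all
  then show ?thesis unfolding pa pb by simp
qed

text \<open>Here the order of the runners does matter: bead \<open>4 * M + i\<close> jumps over
  \<open>3 * M + j\<close> only if \<open>i < j\<close>, and bead \<open>3 * M + j\<close> meets the
  gap at \<open>2 * M + i\<close> only if \<open>j < i\<close>. These order signs are the ones
  summed in \<open>sum_signed_off_diagonal\<close>.\<close>

lemma lower_row2_hook: "lower M F (desc (row2_hook i j)) =
    (if i < j then - 1 else 1) * F (desc (hooks2 i j)) + (if i < j then - 1 else 1) * parity_sign (M + j) * F (desc (row2 i))"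
proof -
  have pa: "parity_sign (passed M (row2_hook i j) (4 * M + i)) = (if i < j then - 1 else 1)"
  proof (cases "i < j")
    case True
    then have "{x \<in> row2_hook i j. 4 * M + i - M < x \<and> x < 4 * M + i} = {3 * M + j}"
      using i j ij unfolding config_defs moved_def by auto
    then show ?thesis using i j ij True by (simp add: passed_def parity_sign_def)
  next
    case False
    then have "{x \<in> row2_hook i j. 4 * M + i - M < x \<and> x < 4 * M + i} = {}"
      using i j ij unfolding config_defs moved_def by auto
    then have "passed M (row2_hook i j) (4 * M + i) = 0" by (simp only: passed_def card.empty of_nat_0)
    then show ?thesis using False by (simp add: parity_sign_def)
  qed
  have pb: "parity_sign (passed M (row2_hook i j) (3 * M + j)) = (if i < j then - 1 else 1) * parity_sign (M + j)"
  proof (cases "i < j")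
    case True
    then have "{x \<in> row2_hook i j. 3 * M + j - M < x \<and> x < 3 * M + j} = {2 * M + j<..<3 * M}"
      using i j ij unfolding config_defs moved_def by auto
    then show ?thesis using i j ij True by (simp add: passed_def parity_sign_def)
  next
    case False
    then have "{x \<in> row2_hook i j. 3 * M + j - M < x \<and> x < 3 * M + j} = {2 * M + j<..<3 * M} - {2 * M + i}"
      using i j ij unfolding config_defs moved_def by auto
    then show ?thesis using i j ij False by (simp add: passed_def parity_sign_def)
  qed
  have "{b \<in> row2_hook i j. M \<le> b \<and> b - M \<notin> row2_hook i j} = {4 * M + i, 3 * M + j}"
    using i j ij unfolding config_defs moved_def by auto
  moreover have "moved (4 * M + i) (4 * M + i - M) (row2_hook i j) = hooks2 i j"
    using i j ij unfolding config_defs moved_def by auto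
  moreover have "moved (3 * M + j) (3 * M + j - M) (row2_hook i j) = row2 i"
    using i j ij unfolding config_defs moved_def by auto
  ultimately have "lower M F (desc (row2_hook i j)) = parity_sign (passed M (row2_hook i j) (4 * M + i)) * F (desc (hooks2 i j))
      + parity_sign (passed M (row2_hook i j) (3 * M + j)) * F (desc (row2 i))"
    using i j ij by (intro lower_desc_pair[OF F]) simp_all
  then show ?thesis unfolding pa pb by simp
qed

lemma lower_col2_hook: "lower M F (desc (col2_hook i j)) =
    (if i < j then - 1 else 1) * parity_sign M * F (desc (hooks2 i j)) + (if i < j then 1 else - 1) * parity_sign (M + j) * F (desc (col2 i))"
proof -
  have pa: "parity_sign (passed M (col2_hook i j) (2 * M + i)) = (if i < j then - 1 else 1) * parity_sign M"
  proof (cases "i < j")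
    case True
    then have "{x \<in> col2_hook i j. 2 * M + i - M < x \<and> x < 2 * M + i} = {M + i<..<2 * M + i}"
      using i j ij unfolding config_defs moved_def by auto
    then show ?thesis using i j ij True by (simp add: passed_def parity_sign_def)
  next
    case False
    then have "{x \<in> col2_hook i j. 2 * M + i - M < x \<and> x < 2 * M + i} = {M + i<..<2 * M + i} - {2 * M + j}"
      using i j ij unfolding config_defs moved_def by auto
    then show ?thesis using i j ij False by (simp add: passed_def parity_sign_def)
  qed
  have pb: "parity_sign (passed M (col2_hook i j) (3 * M + j)) = (if i < j then 1 else - 1) * parity_sign (M + j)"
  proof (cases "i < j")
    case True
    then have "{x \<in> col2_hook i j. 3 * M + j - M < x \<and> x < 3 * M + j} = insert (3 * M + i) {2 * M + j<..<3 * M}"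
      using i j ij unfolding config_defs moved_def by auto
    then show ?thesis using i j ij True by (simp add: passed_def parity_sign_def)
  next
    case False
    then have "{x \<in> col2_hook i j. 3 * M + j - M < x \<and> x < 3 * M + j} = {2 * M + j<..<3 * M}"
      using i j ij unfolding config_defs moved_def by auto
    then show ?thesis using i j ij False by (simp add: passed_def parity_sign_def)
  qed
  have "{b \<in> col2_hook i j. M \<le> b \<and> b - M \<notin> col2_hook i j} = {2 * M + i, 3 * M + j}"
    using i j ij unfolding config_defs moved_def by auto
  moreover have "moved (2 * M + i) (2 * M + i - M) (col2_hook i j) = hooks2 i j"
    using i j ij unfolding config_defs moved_def by auto
  moreover have "moved (3 * M + j) (3 * M + j - M) (col2_hook i j) = col2 i"
    using i j ij unfolding config_defs moved_def by auto
  ultimately have "lower M F (desc (col2_hook i j)) = parity_sign (passed M (col2_hook i j) (2 * M + i)) * F (desc (hooks2 i j))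
      + parity_sign (passed M (col2_hook i j) (3 * M + j)) * F (desc (col2 i))"
    using i j ij by (intro lower_desc_pair[OF F]) simp_all
  then show ?thesis unfolding pa pb by simp
qed

end

end

end

text \<open>The ribbon rule read backwards: a nonzero value forces a nonzero summand, so
  \<open>B\<close> comes from some \<open>C\<close> of nonzero value by adding a ribbon.\<close>

lemma lower_desc_nonzeroE:
  assumes "admissible F" "finite B" "0 < r" "lower r F (desc B) \<noteq> 0"
  obtains C c where "finite C" "0 \<le> c" "c \<in> C" "c + r \<notin> C" "B = moved c (c + r) C" "F (desc C) \<noteq> 0"
proof -
  let ?S = "{b \<in> B. r \<le> b \<and> b - r \<notin> B}"
  have "(\<Sum>b\<in>?S. parity_sign (passed r B b) * F (desc (moved b (b - r) B))) \<noteq> 0"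
    using lower_desc_sum[OF assms(1-3) refl] assms(4) by simp
  then obtain b where b: "b \<in> ?S" "F (desc (moved b (b - r) B)) \<noteq> 0"
    by (metis (no_types, lifting) mult_zero_right sum.neutral)
  show ?thesis
  proof (rule that[of "moved b (b - r) B" "b - r"])
    show "B = moved (b - r) (b - r + r) (moved b (b - r) B)"
      using b(1) assms(3) unfolding moved_def by auto
  qed (use b assms in \<open>auto simp: moved_def\<close>)
qed

lemma card_sum_moved:
  assumes "finite B" "a \<in> B" "b \<notin> B"
  shows "card (moved a b B) = card B" "\<Sum>(moved a b B) = \<Sum>B + b - a"
  using assms card_Suc_Diff1[of B a] unfolding moved_def by (auto simp: sum_diff1)

section \<open>Adding ribbons of length M to the configurations\<close>

context
  fixes M :: int
begin

context
  fixes F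
  assumes F: "admissible F" and M: "0 < M"
begin

text \<open>Each of the three removable ribbons leads to a \<open>hooks2\<close> configuration, from
  which evenness is inherited. Behind this are the 6 orders in which three hooks on distinct runners
  can be added.\<close>

lemma even_lower_hooks3:
  assumes i: "0 \<le> i" "i < M" and j: "0 \<le> j" "j < M" "i \<noteq> j" and l: "0 \<le> l" "l < M" "l \<noteq> i" "l \<noteq> j"
    and even: "\<And>i j. 0 \<le> i \<Longrightarrow> i < M \<Longrightarrow> 0 \<le> j \<Longrightarrow> j < M \<Longrightarrow> i \<noteq> j \<Longrightarrow> even (F (desc (hooks2 M i j)))"
  shows "even (lower M F (desc (hooks3 M i j l)))"
proof -
  let ?B = "hooks3 M i j l"
  have S: "{b \<in> ?B. M \<le> b \<and> b - M \<notin> ?B} = {3 * M + i, 3 * M + j, 3 * M + l}"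
    using i j l unfolding config_defs moved_def by auto
  have m: "moved (3 * M + i) (3 * M + i - M) ?B = hooks2 M j l"
    "moved (3 * M + j) (3 * M + j - M) ?B = hooks2 M i l"
    "moved (3 * M + l) (3 * M + l - M) ?B = hooks2 M i j"
    using i j l unfolding config_defs moved_def by auto
  show ?thesis
    unfolding lower_desc_sum[OF F finite_config(11) M S]
    using i j l m even by (intro dvd_sum dvd_mult) auto
qed

end

lemma up_ground:
  assumes "0 \<le> c" "c \<in> ground M" "c + M \<notin> ground M"
  obtains i where "0 \<le> i" "i < M" "moved c (c + M) (ground M) = hook M i"
proof -
  have "2 * M \<le> c" "c < 3 * M" using assms unfolding ground_def by auto
  then show ?thesis
    by (intro that[of "c - 2 * M"]) (simp_all add: hook_def algebra_simps)
qed

text \<open>The beads that can move up are the addable cells of the quotient: the raised bead of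
  runner \<open>i\<close>, the bead just below its gap, and the top bead of any other runner. The
  next lemmas are analogous.\<close>

lemma up_hook:
  assumes i: "0 \<le> i" "i < M" and c: "0 \<le> c" "c \<in> hook M i" "c + M \<notin> hook M i"
  obtains "moved c (c + M) (hook M i) = row2 M i"
  | "moved c (c + M) (hook M i) = col2 M i"
  | j where "0 \<le> j" "j < M" "i \<noteq> j" "moved c (c + M) (hook M i) = hooks2 M i j"
proof -
  have "(c = 3 * M + i)
      \<or> (c = M + i)
      \<or> (2 * M \<le> c \<and> c < 3 * M \<and> c \<noteq> 2 * M + i)"
    using c i unfolding config_defs moved_def by auto
  then consider "c = 3 * M + i" | "c = M + i" | "2 * M \<le> c" "c < 3 * M" "c \<noteq> 2 * M + i"
    by blast
  then show ?thesis
  proof cases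
    case 1
    then have "moved c (c + M) (hook M i) = row2 M i"
      using i unfolding config_defs moved_def by auto
    then show ?thesis by (rule that)
  next
    case 2
    then have "moved c (c + M) (hook M i) = col2 M i"
      using i unfolding config_defs moved_def by auto
    then show ?thesis by (rule that)
  next
    case 3
    then show ?thesis
      by (intro that(3)[of "c - 2 * M"]) (simp_all add: hooks2_def algebra_simps)
  qed
qed

lemma up_row2:
  assumes i: "0 \<le> i" "i < M" and c: "0 \<le> c" "c \<in> row2 M i" "c + M \<notin> row2 M i"
  obtains "moved c (c + M) (row2 M i) = row3 M i"
  | "moved c (c + M) (row2 M i) = mid3 M i"
  | j where "0 \<le> j" "j < M" "i \<noteq> j" "moved c (c + M) (row2 M i) = row2_hook M i j"
proof -
  have "(c = 4 * M + i)
      \<or> (c = M + i)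
      \<or> (2 * M \<le> c \<and> c < 3 * M \<and> c \<noteq> 2 * M + i)"
    using c i unfolding config_defs moved_def by auto
  then consider "c = 4 * M + i" | "c = M + i" | "2 * M \<le> c" "c < 3 * M" "c \<noteq> 2 * M + i"
    by blast
  then show ?thesis
  proof cases
    case 1
    then have "moved c (c + M) (row2 M i) = row3 M i"
      using i unfolding config_defs moved_def by auto
    then show ?thesis by (rule that)
  next
    case 2
    then have "moved c (c + M) (row2 M i) = mid3 M i"
      using i unfolding config_defs moved_def by auto
    then show ?thesis by (rule that)
  next
    case 3
    then show ?thesis
      by (intro that(3)[of "c - 2 * M"]) (simp_all add: row2_hook_def algebra_simps)
  qed
qed

lemma up_col2:
  assumes i: "0 \<le> i" "i < M" and c: "0 \<le> c" "c \<in> col2 M i" "c + M \<notin> col2 M i"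
  obtains "moved c (c + M) (col2 M i) = col3 M i"
  | "moved c (c + M) (col2 M i) = mid3 M i"
  | j where "0 \<le> j" "j < M" "i \<noteq> j" "moved c (c + M) (col2 M i) = col2_hook M i j"
proof -
  have "(c = i)
      \<or> (c = 3 * M + i)
      \<or> (2 * M \<le> c \<and> c < 3 * M \<and> c \<noteq> 2 * M + i)"
    using c i unfolding config_defs moved_def by auto
  then consider "c = i" | "c = 3 * M + i" | "2 * M \<le> c" "c < 3 * M" "c \<noteq> 2 * M + i"
    by blast
  then show ?thesis
  proof cases
    case 1
    then have "moved c (c + M) (col2 M i) = col3 M i"
      using i unfolding config_defs moved_def by auto
    then show ?thesis by (rule that)
  next
    case 2
    then have "moved c (c + M) (col2 M i) = mid3 M i"
      using i unfolding config_defs moved_def by auto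
    then show ?thesis by (rule that)
  next
    case 3
    then show ?thesis
      by (intro that(3)[of "c - 2 * M"]) (simp_all add: col2_hook_def algebra_simps)
  qed
qed

lemma up_hooks2:
  assumes i: "0 \<le> i" "i < M" and j: "0 \<le> j" "j < M" "i \<noteq> j"
    and c: "0 \<le> c" "c \<in> hooks2 M i j" "c + M \<notin> hooks2 M i j"
  obtains "moved c (c + M) (hooks2 M i j) = row2_hook M i j"
  | "moved c (c + M) (hooks2 M i j) = row2_hook M j i"
  | "moved c (c + M) (hooks2 M i j) = col2_hook M i j"
  | "moved c (c + M) (hooks2 M i j) = col2_hook M j i"
  | l where "0 \<le> l" "l < M" "l \<noteq> i" "l \<noteq> j" "moved c (c + M) (hooks2 M i j) = hooks3 M i j l"
proof -
  have "(c = 3 * M + i)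
      \<or> (c = 3 * M + j)
      \<or> (c = M + i)
      \<or> (c = M + j)
      \<or> (2 * M \<le> c \<and> c < 3 * M \<and> c \<noteq> 2 * M + i \<and> c \<noteq> 2 * M + j)"
    using c i j unfolding config_defs moved_def by auto
  then consider "c = 3 * M + i" | "c = 3 * M + j" | "c = M + i" | "c = M + j"
    | "2 * M \<le> c" "c < 3 * M" "c \<noteq> 2 * M + i" "c \<noteq> 2 * M + j"
    by blast
  then show ?thesis
  proof cases
    case 1
    then have "moved c (c + M) (hooks2 M i j) = row2_hook M i j"
      using i j unfolding config_defs moved_def by auto
    then show ?thesis by (rule that)
  next
    case 2
    then have "moved c (c + M) (hooks2 M i j) = row2_hook M j i"
      using i j unfolding config_defs moved_def by auto
    then show ?thesis by (rule that)
  next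
    case 3
    then have "moved c (c + M) (hooks2 M i j) = col2_hook M i j"
      using i j unfolding config_defs moved_def by auto
    then show ?thesis by (rule that)
  next
    case 4
    then have "moved c (c + M) (hooks2 M i j) = col2_hook M j i"
      using i j unfolding config_defs moved_def by auto
    then show ?thesis by (rule that)
  next
    case 5
    then show ?thesis
      by (intro that(5)[of "c - 2 * M"]) (simp_all add: hooks3_def algebra_simps)
  qed
qed

text \<open>Each step has a single removable ribbon of length \<open>h\<close>. For
  \<open>i < h\<close> the bead \<open>2 * M + h + i\<close> first fills the gap and
  \<open>3 * M + i\<close> then takes its place; for \<open>i >= h\<close> the bead
  \<open>3 * M + i\<close> moves down twice. The beads passed number \<open>2 * h - 2 - i\<close>
  and \<open>2 * h - 1 - i\<close> in total, hence the opposite signs on the two halves.\<close>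

lemma lower_half_hook:
  assumes F: "admissible F" and h: "M = 2 * h" and i: "0 \<le> i" "i < M"
  shows "lower h (lower h F) (desc (hook M i)) =
    (if i < h then parity_sign i else - parity_sign i) * F (desc (ground M))"
proof (cases "i < h")
  case True
  let ?B = "hook M i" and ?C = "moved (2 * M + h + i) (3 * M + i) (ground M)"
  have "{x \<in> ?B. 2 * M + h + i - h < x \<and> x < 2 * M + h + i} = {2 * M + i<..<2 * M + h + i}"
    using i h True unfolding config_defs moved_def by auto
  then have pB: "passed h ?B (2 * M + h + i) = h - 1" using i True by (simp add: passed_def)
  have "{x \<in> ?C. 3 * M + i - h < x \<and> x < 3 * M + i} = {2 * M + h + i<..<3 * M}"
    using i h True unfolding config_defs moved_def by auto
  then have pC: "passed h ?C (3 * M + i) = h - 1 - i" using i h True by (simp add: passed_def)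
  have "{b \<in> ?B. h \<le> b \<and> b - h \<notin> ?B} = {2 * M + h + i}"
    using i h True unfolding config_defs moved_def by auto
  moreover have "moved (2 * M + h + i) (2 * M + h + i - h) ?B = ?C"
    using i h True unfolding config_defs moved_def by auto
  ultimately have 1: "lower h (lower h F) (desc ?B) = parity_sign (passed h ?B (2 * M + h + i)) * lower h F (desc ?C)"
    using i True F by (intro lower_desc_single admissible_lower) simp_all
  have "{b \<in> ?C. h \<le> b \<and> b - h \<notin> ?C} = {3 * M + i}"
    using i h True unfolding config_defs moved_def by auto
  moreover have "moved (3 * M + i) (3 * M + i - h) ?C = ground M"
    using i h True unfolding config_defs moved_def by auto
  ultimately have 2: "lower h F (desc ?C) = parity_sign (passed h ?C (3 * M + i)) * F (desc (ground M))"
    using i True F by (intro lower_desc_single) simp_all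
  show ?thesis unfolding 1 2 pB pC using True by (simp add: parity_sign_def)
next
  case False
  let ?B = "hook M i" and ?C = "moved (2 * M + i) (3 * M + i - h) (ground M)"
  have "{x \<in> ?B. 3 * M + i - h < x \<and> x < 3 * M + i} = {}"
    using i h False unfolding config_defs moved_def by auto
  then have pB: "passed h ?B (3 * M + i) = 0" by (simp only: passed_def card.empty of_nat_0)
  have "{x \<in> ?C. 3 * M + i - h - h < x \<and> x < 3 * M + i - h} = {2 * M + i<..<3 * M}"
    using i h False unfolding config_defs moved_def by auto
  then have pC: "passed h ?C (3 * M + i - h) = M - 1 - i" using i by (simp add: passed_def)
  have "{b \<in> ?B. h \<le> b \<and> b - h \<notin> ?B} = {3 * M + i}"
    using i h False unfolding config_defs moved_def by auto
  moreover have "moved (3 * M + i) (3 * M + i - h) ?B = ?C"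
    using i h False unfolding config_defs moved_def by auto
  ultimately have 1: "lower h (lower h F) (desc ?B) = parity_sign (passed h ?B (3 * M + i)) * lower h F (desc ?C)"
    using i h F by (intro lower_desc_single admissible_lower) simp_all
  have "{b \<in> ?C. h \<le> b \<and> b - h \<notin> ?C} = {3 * M + i - h}"
    using i h False unfolding config_defs moved_def by auto
  moreover have "moved (3 * M + i - h) (3 * M + i - h - h) ?C = ground M"
    using i h False unfolding config_defs moved_def by auto
  ultimately have 2: "lower h F (desc ?C) = parity_sign (passed h ?C (3 * M + i - h)) * F (desc (ground M))"
    using i h F by (intro lower_desc_single) simp_all
  show ?thesis unfolding 1 2 pB pC using False h by (simp add: parity_sign_def)
qed

end

lemma config_in_bead_sets:
  fixes M i j :: int
  assumes n: "3 * M = int n" and i: "0 \<le> i" "i < M"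
  shows "row3 M i \<in> bead_sets n" "col3 M i \<in> bead_sets n"
    "0 \<le> j \<Longrightarrow> j < M \<Longrightarrow> i \<noteq> j \<Longrightarrow> row2_hook M i j \<in> bead_sets n"
    "0 \<le> j \<Longrightarrow> j < M \<Longrightarrow> i \<noteq> j \<Longrightarrow> col2_hook M i j \<in> bead_sets n"
proof -
  have g: "card (ground M) = n" "\<Sum>(ground M) = \<Sum>{0..<int n}"
    using n by (simp_all add: ground_def)
  have one: "card (moved a b (ground M)) = n" "\<Sum>(moved a b (ground M)) = \<Sum>{0..<int n} + b - a"
    if "0 \<le> a" "a < 3 * M" "3 * M \<le> b" for a b
    using card_sum_moved[of "ground M" a b] that g by (simp_all add: ground_def)
  have two: "card (moved a' b' (moved a b (ground M))) = n"
    "\<Sum>(moved a' b' (moved a b (ground M))) = \<Sum>{0..<int n} + b - a + b' - a'"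
    if "0 \<le> a" "a < 3 * M" "3 * M \<le> b" "0 \<le> a'" "a' < 3 * M" "3 * M \<le> b'" "a \<noteq> a'" "b \<noteq> b'" for a b a' b'
    using card_sum_moved[of "moved a b (ground M)" a' b'] one[of a b] that
    by (simp_all add: ground_def moved_def)
  show "row3 M i \<in> bead_sets n"
  proof -
    have "\<forall>b\<in>row3 M i. 0 \<le> b" using i  unfolding config_defs moved_def by auto
    moreover have "card (row3 M i) = n" "\<Sum>(row3 M i) = 3 * M + \<Sum>{0..<int n}"
      using one[of "2 * M + i" "5 * M + i"] i  by (simp_all add: row3_def)
    ultimately show ?thesis by (simp add: bead_sets_def n)
  qed
  show "col3 M i \<in> bead_sets n"
  proof -
    have "\<forall>b\<in>col3 M i. 0 \<le> b" using i  unfolding config_defs moved_def by auto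
    moreover have "card (col3 M i) = n" "\<Sum>(col3 M i) = 3 * M + \<Sum>{0..<int n}"
      using one[of i "3 * M + i"] i  by (simp_all add: col3_def)
    ultimately show ?thesis by (simp add: bead_sets_def n)
  qed
  show "row2_hook M i j \<in> bead_sets n" if ij: "0 \<le> j" "j < M" "i \<noteq> j"
  proof -
    have "\<forall>b\<in>row2_hook M i j. 0 \<le> b" using i ij unfolding config_defs moved_def by auto
    moreover have "card (row2_hook M i j) = n" "\<Sum>(row2_hook M i j) = 3 * M + \<Sum>{0..<int n}"
      using two[of "2 * M + i" "4 * M + i" "2 * M + j" "3 * M + j"] i ij by (simp_all add: row2_hook_def row2_def)
    ultimately show ?thesis by (simp add: bead_sets_def n)
  qed
  show "col2_hook M i j \<in> bead_sets n" if ij: "0 \<le> j" "j < M" "i \<noteq> j"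
  proof -
    have "\<forall>b\<in>col2_hook M i j. 0 \<le> b" using i ij unfolding config_defs moved_def by auto
    moreover have "card (col2_hook M i j) = n" "\<Sum>(col2_hook M i j) = 3 * M + \<Sum>{0..<int n}"
      using two[of "M + i" "3 * M + i" "2 * M + j" "3 * M + j"] i ij by (simp_all add: col2_hook_def col2_def)
    ultimately show ?thesis by (simp add: bead_sets_def n)
  qed
qed

section \<open>Counting residues modulo 4\<close>

text \<open>The nontrivial Dirichlet character modulo 4. Its sum over the values of
  \<open>f_lam\<close> is \<open>delta\<close>, and the sum of its squares counts the odd
  values.\<close>

definition sign4 :: "int \<Rightarrow> int" where
  "sign4 v = (if v mod 4 = 1 then 1 else if v mod 4 = 3 then - 1 else 0)"

lemma sign4_cong: "[v = w] (mod 4) \<Longrightarrow> sign4 v = sign4 w"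
  by (simp add: sign4_def cong_def)

lemma sign4_uminus: "sign4 (- v) = - sign4 v"
  unfolding sign4_def by presburger

lemma sign4_even: "even v \<Longrightarrow> sign4 v = 0"
  unfolding sign4_def by presburger

lemma sign4_odd: "odd v \<Longrightarrow> sign4 v = 1 \<or> sign4 v = - 1"
  unfolding sign4_def by presburger

lemma sign4_parity_sign: "sign4 (parity_sign k) = parity_sign k"
  by (simp add: sign4_def parity_sign_def)

lemma sum_sign4:
  assumes "finite A"
  shows "(\<Sum>B\<in>A. sign4 (f B)) = int (card {B \<in> A. f B mod 4 = 1}) - int (card {B \<in> A. f B mod 4 = 3})"
    and "(\<Sum>B\<in>A. (sign4 (f B))\<^sup>2) = int (card {B \<in> A. f B mod 4 = 1}) + int (card {B \<in> A. f B mod 4 = 3})"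
proof -
  have c: "int (card {B \<in> A. P B}) = (\<Sum>B\<in>A. if P B then 1 else 0)" for P
    using assms by (simp add: sum.If_cases Int_def)
  show "(\<Sum>B\<in>A. sign4 (f B)) = int (card {B \<in> A. f B mod 4 = 1}) - int (card {B \<in> A. f B mod 4 = 3})"
    unfolding c by (simp add: sum_subtractf[symmetric] sign4_def cong: if_cong) (intro sum.cong, auto)
  show "(\<Sum>B\<in>A. (sign4 (f B))\<^sup>2) = int (card {B \<in> A. f B mod 4 = 1}) + int (card {B \<in> A. f B mod 4 = 3})"
    unfolding c by (simp add: sum.distrib[symmetric] sign4_def cong: if_cong) (intro sum.cong, auto)
qed

lemma sum_parity_sign: "(\<Sum>i\<in>{0..<int k}. parity_sign i) = (if odd k then 1 else 0)"
proof (induction k)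
  case (Suc k)
  have "{0..<int (Suc k)} = insert (int k) {0..<int k}" by auto
  then show ?case using Suc by (simp add: parity_sign_def)
qed simp

lemma sum_parity_sign_int: "0 \<le> k \<Longrightarrow> (\<Sum>i\<in>{0..<k}. parity_sign i) = (if odd k then 1 else 0)"
  using sum_parity_sign[of "nat k"] by (simp add: even_nat_iff)

lemma sum_int_interval_concat:
  fixes a b c :: int
  assumes "a \<le> b" "b \<le> c"
  shows "sum f {a..<b} + sum f {b..<c} = sum f {a..<c}"
proof -
  have "{a..<c} = {a..<b} \<union> {b..<c}" using assms by auto
  then show ?thesis by (simp add: sum.union_disjoint)
qed

text \<open>The sum of \<open>parity_sign\<close> below \<open>j\<close> is 1 for odd
  \<open>j\<close> and 0 otherwise. As the full sum is 0, the sum above \<open>j\<close> is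
  \<open>- 1\<close> for even \<open>j\<close> and 0 otherwise. Subtracting the former from the
  latter gives \<open>- 1\<close> for every \<open>j\<close>.\<close>

lemma sum_signed_off_diagonal:
  assumes "even M" "0 \<le> j" "j < M"
  shows "(\<Sum>i\<in>{0..<M} - {j}. (if i < j then - 1 else 1) * parity_sign i) = - 1"
proof -
  have "{0..<M} = {0..<j} \<union> insert j {j + 1..<M}" "{0..<M} - {j} = {0..<j} \<union> {j + 1..<M}"
    using assms by auto
  then have "(\<Sum>i\<in>{0..<M} - {j}. (if i < j then - 1 else 1) * parity_sign i)
      = (\<Sum>i\<in>{0..<j}. - parity_sign i) + (\<Sum>i\<in>{j + 1..<M}. parity_sign i)"
    by (simp add: sum.union_disjoint)
  moreover have "(\<Sum>i\<in>{0..<M}. parity_sign i) = (\<Sum>i\<in>{0..<j + 1}. parity_sign i) + (\<Sum>i\<in>{j + 1..<M}. parity_sign i)"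
    using assms by (intro sum_int_interval_concat[symmetric]) auto
  ultimately show ?thesis
    using assms sum_parity_sign_int[of M] sum_parity_sign_int[of "j + 1"] sum_parity_sign_int[of j]
    by (auto simp: sum_negf split: if_splits)
qed

text \<open>The runner \<open>j\<close> of the single hook comes first: the outer sum runs over
  \<open>j\<close>, the inner one over \<open>i\<close>.\<close>

definition off_diagonal :: "int \<Rightarrow> (int \<times> int) set" where
  "off_diagonal M = (SIGMA j:{0..<M}. {0..<M} - {j})"

text \<open>Up to signs, the value modulo 2 is the number of ways to build the quotient cell by
  cell. This is 1 for \<open>(3)\<close> and \<open>(1,1,1)\<close>, and 3 for a domino and a cell
  on two runners, but 2 for \<open>(2,1)\<close> and 6 for three separate cells.\<close>

definition odd_configs :: "int \<Rightarrow> int set set" where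
  "odd_configs M = row3 M ` {0..<M} \<union> col3 M ` {0..<M}
     \<union> (\<lambda>(j, i). row2_hook M i j) ` off_diagonal M \<union> (\<lambda>(j, i). col2_hook M i j) ` off_diagonal M"

lemma finite_off_diagonal: "finite (off_diagonal M)"
  by (simp add: off_diagonal_def)

lemma mem_config:
  assumes "0 \<le> i" "i < M"
  shows "x \<in> row3 M i \<longleftrightarrow> 0 \<le> x \<and> x < 3 * M \<and> x \<noteq> 2 * M + i \<or> x = 5 * M + i"
    "x \<in> col3 M i \<longleftrightarrow> 0 \<le> x \<and> x < 3 * M \<and> x \<noteq> i \<or> x = 3 * M + i"
    "0 \<le> j \<Longrightarrow> j < M \<Longrightarrow> x \<in> row2_hook M i j \<longleftrightarrow>
      0 \<le> x \<and> x < 3 * M \<and> x \<noteq> 2 * M + i \<and> x \<noteq> 2 * M + j \<or> x = 4 * M + i \<or> x = 3 * M + j"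
    "0 \<le> j \<Longrightarrow> j < M \<Longrightarrow> x \<in> col2_hook M i j \<longleftrightarrow>
      0 \<le> x \<and> x < 3 * M \<and> x \<noteq> M + i \<and> x \<noteq> 2 * M + j \<or> x = 3 * M + i \<or> x = 3 * M + j"
  using assms unfolding config_defs moved_def by auto

text \<open>The families are told apart by their extreme rows: \<open>row3\<close> has a bead in row
  5, \<open>row2_hook\<close> has its highest bead in row 4, and of the other two only
  \<open>col3\<close> has a gap in row 0.\<close>

lemma sum_odd_configs:
  fixes g :: "int set \<Rightarrow> int"
  shows "(\<Sum>B\<in>odd_configs M. g B) = (\<Sum>i\<in>{0..<M}. g (row3 M i)) + (\<Sum>i\<in>{0..<M}. g (col3 M i))
    + (\<Sum>(j, i)\<in>off_diagonal M. g (row2_hook M i j)) + (\<Sum>(j, i)\<in>off_diagonal M. g (col2_hook M i j))"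
proof -
  let ?I = "{0..<M}" and ?Q = "off_diagonal M"
  let ?r = "\<lambda>(j, i). row2_hook M i j" and ?c = "\<lambda>(j, i). col2_hook M i j"
  have Q: "0 \<le> i" "i < M" "0 \<le> j" "j < M" "i \<noteq> j" if "(j, i) \<in> ?Q" for i j
    using that by (auto simp: off_diagonal_def)
  have inj: "inj_on (row3 M) ?I" "inj_on (col3 M) ?I"
  proof (rule inj_onI)
    fix i j assume ij: "i \<in> ?I" "j \<in> ?I" "row3 M i = row3 M j"
    then have "5 * M + i \<in> row3 M j" using mem_config(1)[of i M "5 * M + i"] by auto
    then show "i = j" using ij mem_config(1)[of j M "5 * M + i"] by auto
  next
    show "inj_on (col3 M) ?I"
    proof (rule inj_onI)
      fix i j assume ij: "i \<in> ?I" "j \<in> ?I" "col3 M i = col3 M j"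
      then have "3 * M + i \<in> col3 M j" using mem_config(2)[of i M "3 * M + i"] by auto
      then show "i = j" using ij mem_config(2)[of j M "3 * M + i"] by auto
    qed
  qed
  have injr: "inj_on ?r ?Q"
  proof (rule inj_onI, clarify)
    fix j i j' i' assume q: "(j, i) \<in> ?Q" "(j', i') \<in> ?Q" "row2_hook M i j = row2_hook M i' j'"
    note m = mem_config(3)[OF Q(1-4)[OF q(1)]] and m' = mem_config(3)[OF Q(1-4)[OF q(2)]]
    have "4 * M + i \<in> row2_hook M i' j'" "3 * M + j \<in> row2_hook M i' j'"
      unfolding q(3)[symmetric] m by simp_all
    then show "j = j' \<and> i = i'" unfolding m' using Q[OF q(1)] Q[OF q(2)] by auto
  qed
  have injc: "inj_on ?c ?Q"
  proof (rule inj_onI, clarify)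
    fix j i j' i' assume q: "(j, i) \<in> ?Q" "(j', i') \<in> ?Q" "col2_hook M i j = col2_hook M i' j'"
    note m = mem_config(4)[OF Q(1-4)[OF q(1)]] and m' = mem_config(4)[OF Q(1-4)[OF q(2)]]
    \<comment> \<open>The beads \<open>3 * M + i\<close> and \<open>3 * M + j\<close> do not
      distinguish \<open>i\<close> from \<open>j\<close>; the gaps in rows 1 and 2 do.\<close>
    have "M + i \<notin> col2_hook M i' j'" "2 * M + j \<notin> col2_hook M i' j'"
      unfolding q(3)[symmetric] m using Q[OF q(1)] by simp_all
    then show "j = j' \<and> i = i'" unfolding m' using Q[OF q(1)] Q[OF q(2)] by auto
  qed
  have "row3 M i \<noteq> col3 M j" if ij: "0 \<le> i" "i < M" "0 \<le> j" "j < M" for i j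
    using mem_config(1)[OF ij(1,2), of "5 * M + i"] mem_config(2)[OF ij(3,4), of "5 * M + i"] ij by auto
  then have d1: "row3 M ` ?I \<inter> col3 M ` ?I = {}" by force
  have "row3 M l \<noteq> row2_hook M i j \<and> col3 M l \<noteq> row2_hook M i j" if ij: "(j, i) \<in> ?Q" and l: "0 \<le> l" "l < M" for i j l
    using mem_config(1)[OF l, of "4 * M + i"] mem_config(2)[OF l, of "4 * M + i"]
      mem_config(3)[OF Q(1-4)[OF ij], of "4 * M + i"] mem_config(1)[OF l, of "3 * M + j"]
      mem_config(3)[OF Q(1-4)[OF ij], of "3 * M + j"] Q[OF ij] l by auto
  then have d2: "(row3 M ` ?I \<union> col3 M ` ?I) \<inter> ?r ` ?Q = {}" by force
  have "row3 M l \<noteq> col2_hook M i j \<and> col3 M l \<noteq> col2_hook M i j" if ij: "(j, i) \<in> ?Q" and l: "0 \<le> l" "l < M" for i j l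
    using mem_config(1)[OF l, of "5 * M + l"] mem_config(2)[OF l, of l]
      mem_config(4)[OF Q(1-4)[OF ij], of "5 * M + l"]
      mem_config(4)[OF Q(1-4)[OF ij], of l] Q[OF ij] l by auto
  note r1 = this
  have r2: "row2_hook M i j \<noteq> col2_hook M i' j'" if ij: "(j, i) \<in> ?Q" "(j', i') \<in> ?Q" for i j i' j'
    using mem_config(3)[OF Q(1-4)[OF ij(1)], of "4 * M + i"]
      mem_config(4)[OF Q(1-4)[OF ij(2)], of "4 * M + i"] Q[OF ij(1)] Q[OF ij(2)] by auto
  have d3: "(row3 M ` ?I \<union> col3 M ` ?I \<union> ?r ` ?Q) \<inter> ?c ` ?Q = {}"
  proof (rule equals0I)
    fix B assume B: "B \<in> (row3 M ` ?I \<union> col3 M ` ?I \<union> ?r ` ?Q) \<inter> ?c ` ?Q"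
    then obtain j i where q: "(j, i) \<in> ?Q" "B = col2_hook M i j" by auto
    from B consider l where "l \<in> ?I" "B = row3 M l \<or> B = col3 M l" | j' i' where "(j', i') \<in> ?Q" "B = row2_hook M i' j'"
      by auto
    then show False
    proof cases
      case 1
      then show False using r1[OF q(1), of l] q(2) by auto
    next
      case 2
      then show False using r2[OF 2(1) q(1)] q(2) by simp
    qed
  qed
  have fin: "finite (row3 M ` ?I)" "finite (col3 M ` ?I)" "finite (?r ` ?Q)" "finite (?c ` ?Q)"
    by (simp_all add: finite_off_diagonal)
  have "sum g (odd_configs M) = sum g (row3 M ` ?I) + sum g (col3 M ` ?I) + sum g (?r ` ?Q) + sum g (?c ` ?Q)"
    unfolding odd_configs_def
    by (simp only: sum.union_disjoint[OF _ _ d3] sum.union_disjoint[OF _ _ d2]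
        sum.union_disjoint[OF _ _ d1] fin finite_Un simp_thms)
  also have "sum g (?r ` ?Q) = (\<Sum>(j, i)\<in>?Q. g (row2_hook M i j))"
    unfolding sum.reindex[OF injr] by (intro sum.cong) auto
  also have "sum g (?c ` ?Q) = (\<Sum>(j, i)\<in>?Q. g (col2_hook M i j))"
    unfolding sum.reindex[OF injc] by (intro sum.cong) auto
  finally show ?thesis by (simp add: sum.reindex[OF inj(1)] sum.reindex[OF inj(2)])
qed

section \<open>Values modulo 4 for n = 3M with M a power of 2\<close>

context
  fixes a m n :: nat and M :: int and F :: "int list \<Rightarrow> int"
  assumes m: "m = 2 ^ a" and M: "M = int m" and n: "n = 3 * m"
    and F: "F = (lower 1 ^^ m) (perm_sign n)"
begin

lemma M_pos: "0 < M" by (simp add: M m)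

lemma M_even: "a \<noteq> 0 \<Longrightarrow> even M" by (simp add: M m)

lemma admissible_F: "admissible F"
  unfolding F by (intro admissible_funpow_lower admissible_perm_sign) simp

lemma perm_sign_ground: "finite B \<Longrightarrow> perm_sign n (desc B) = (if B = ground M then 1 else 0)"
  by (simp add: perm_sign_desc ground_def M n)

text \<open>The \<open>3 * m\<close> lowerings are split into an outer block of
  \<open>2 * m\<close>, which collapses to two lowerings by \<open>M\<close>, and an inner block of
  \<open>m\<close>, which is kept exactly as \<open>F\<close>.\<close>

lemma bead_f_mod4: "[bead_f n B = lower M (lower M F) (desc B)] (mod 4)"
proof -
  have "lower 1 ^^ n = (lower 1 ^^ (2 * 2 ^ a)) \<circ> (lower 1 ^^ m)"
    unfolding funpow_add[symmetric] by (simp add: n m)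
  then have "bead_f n B = (lower 1 ^^ (2 * 2 ^ a)) F (desc B)" by (simp add: bead_f_def F)
  also have "[\<dots> = (lower (2 ^ a * 1) ^^ 2) F (desc B)] (mod 4)" by (rule lower_power_of_2_mod4)
  finally show ?thesis by (simp add: M m eval_nat_numeral)
qed

lemma F_mod2: "[F xs = lower M (perm_sign n) xs] (mod 2)"
  using lower_power_of_2_mod2[of a 1 "perm_sign n" xs] by (simp add: F M m)

lemma bead_f_mod2: "[bead_f n B = lower M (lower M (lower M (perm_sign n))) (desc B)] (mod 2)"
proof -
  have "[bead_f n B = lower M (lower M F) (desc B)] (mod 2)"
    using bead_f_mod4[of B] by (rule cong_dvd_modulus) simp
  also have "[lower M (lower M F) (desc B) = lower M (lower M (lower M (perm_sign n))) (desc B)] (mod 2)"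
    by (intro lower_cong_mod F_mod2)
  finally show ?thesis .
qed

text \<open>Modulo 2 the \<open>m\<close> lowerings in \<open>F\<close> merge into one by
  \<open>M\<close>, and a hook has just one ribbon of that length. The exact value is the binomial
  coefficient of \<open>M - 1\<close> over \<open>i\<close>.\<close>

lemma odd_F_hook:
  assumes "0 \<le> i" "i < M"
  shows "odd (F (desc (hook M i)))"
proof -
  have "lower M (perm_sign n) (desc (hook M i)) = parity_sign (M - 1 - i)"
    using lower_hook[OF admissible_perm_sign assms] by (simp add: perm_sign_ground)
  then have "[F (desc (hook M i)) = parity_sign (M - 1 - i)] (mod 2)"
    using F_mod2[of "desc (hook M i)"] by simp
  then have "even (F (desc (hook M i))) \<longleftrightarrow> even (parity_sign (M - 1 - i))" by (rule cong_dvd_iff)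
  then show ?thesis by (simp add: parity_sign_def)
qed

text \<open>Modulo 4 the merging stops one step earlier, at two lowerings by
  \<open>h = M / 2\<close>, which \<open>lower_half_hook\<close> evaluates.\<close>

lemma sign4_F_hook:
  assumes "M = 2 * h" "0 \<le> i" "i < M"
  shows "sign4 (F (desc (hook M i))) = (if i < h then parity_sign i else - parity_sign i)"
proof -
  have "a \<noteq> 0"
  proof
    assume "a = 0"
    then have "2 * h = 1" using assms(1) M m by simp
    then show False by presburger
  qed
  then obtain b where b: "a = Suc b" using not0_implies_Suc by blast
  have h: "h = 2 ^ b" using assms(1) M m b by simp
  have "[F (desc (hook M i)) = (lower (2 ^ b * 1) ^^ 2) (perm_sign n) (desc (hook M i))] (mod 4)"
    using lower_power_of_2_mod4[of b 1 "perm_sign n"] by (simp add: F m b)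
  then have "[F (desc (hook M i)) = lower h (lower h (perm_sign n)) (desc (hook M i))] (mod 4)"
    by (simp add: h eval_nat_numeral)
  also have "lower h (lower h (perm_sign n)) (desc (hook M i)) = (if i < h then parity_sign i else - parity_sign i)"
    unfolding lower_half_hook[OF admissible_perm_sign assms] by (simp add: perm_sign_ground)
  finally show ?thesis by (simp add: sign4_cong sign4_uminus sign4_parity_sign)
qed

text \<open>An odd value is nonzero after reduction to three lowerings by \<open>M\<close>, so
  \<open>B\<close> arises from \<open>ground\<close> by adding three ribbons. The \<open>up_\<close>
  lemmas list all outcomes, and those with quotient \<open>(2,1)\<close> or three separate cells are
  excluded by parity.\<close>

lemma odd_bead_f_imp:
  assumes "finite B" and odd: "odd (bead_f n B)"
  shows "B \<in> odd_configs M"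
proof -
  let ?s = "perm_sign n"
  note adm = admissible_perm_sign[of n]
  have M0: "0 \<le> M" using M_pos by simp
  note adm1 = admissible_lower[OF adm M0]
  note adm2 = admissible_lower[OF adm1 M0]
  have odd': "odd (lower M (lower M (lower M ?s)) (desc B))"
    using cong_dvd_iff[OF bead_f_mod2[of B]] odd by simp
  then have "lower M (lower M (lower M ?s)) (desc B) \<noteq> 0" by auto
  from lower_desc_nonzeroE[OF adm2 assms(1) M_pos this] obtain C c where
    C: "finite C" "0 \<le> c" "c \<in> C" "c + M \<notin> C" "B = moved c (c + M) C" "lower M (lower M ?s) (desc C) \<noteq> 0" .
  from lower_desc_nonzeroE[OF adm1 C(1) M_pos C(6)] obtain D d where
    D: "finite D" "0 \<le> d" "d \<in> D" "d + M \<notin> D" "C = moved d (d + M) D" "lower M ?s (desc D) \<noteq> 0" .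
  from lower_desc_nonzeroE[OF adm D(1) M_pos D(6)] obtain E e where
    E: "finite E" "0 \<le> e" "e \<in> E" "e + M \<notin> E" "D = moved e (e + M) E" "?s (desc E) \<noteq> 0" .
  \<comment> \<open>Among decreasing lists only that of \<open>ground\<close> has a nonzero
    coefficient in the alternant, so the chain of ribbons starts there.\<close>
  have "E = ground M" using E(1,6) perm_sign_ground by (auto split: if_splits)
  then obtain i where i: "0 \<le> i" "i < M" and Dh: "D = hook M i"
    using up_ground[of e M] E by metis
  \<comment> \<open>The two removal orders contribute 1 or -1 each, so the total is even.\<close>
  have mid: "B \<noteq> mid3 M k" if k: "0 \<le> k" "k < M" for k
  proof
    assume "B = mid3 M k"
    then have "even (lower M (lower M (lower M ?s)) (desc B))"
      by (simp add: lower_mid3[OF adm2 k] lower_row2[OF adm1 k] lower_col2[OF adm1 k]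
          lower_hook[OF adm k] perm_sign_ground parity_sign_def)
    then show False using odd' by simp
  qed
  have ev: "even (lower M (lower M ?s) (desc (hooks2 M k l)))"
    if k: "0 \<le> k" "k < M" and l: "0 \<le> l" "l < M" "k \<noteq> l" for k l
    by (simp add: lower_hooks2[OF adm1 k l] lower_hook[OF adm k] lower_hook[OF adm l(1,2)]
        perm_sign_ground parity_sign_def)
  have h3: "B \<noteq> hooks3 M i j l" if "0 \<le> j" "j < M" "i \<noteq> j" "0 \<le> l" "l < M" "l \<noteq> i" "l \<noteq> j" for j l
    using even_lower_hooks3[OF adm2 M_pos i that ev] odd' by auto
  have oc: "row3 M i \<in> odd_configs M" "col3 M i \<in> odd_configs M"
    using i by (auto simp: odd_configs_def)
  have oq: "row2_hook M k j \<in> odd_configs M" "col2_hook M k j \<in> odd_configs M"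
    if "0 \<le> k" "k < M" "0 \<le> j" "j < M" "k \<noteq> j" for k j
    using that by (force simp: odd_configs_def off_diagonal_def)+
  from D(2-4) have "C = row2 M i \<or> C = col2 M i \<or> (\<exists>j. 0 \<le> j \<and> j < M \<and> i \<noteq> j \<and> C = hooks2 M i j)"
    unfolding D(5) Dh by (rule up_hook[OF i]) auto
  then consider "C = row2 M i" | "C = col2 M i" | j where "0 \<le> j" "j < M" "i \<noteq> j" "C = hooks2 M i j"
    by blast
  then show ?thesis
  proof cases
    case 1
    have "B = row3 M i \<or> B = mid3 M i \<or> (\<exists>j. 0 \<le> j \<and> j < M \<and> i \<noteq> j \<and> B = row2_hook M i j)"
      using C(2-4) unfolding C(5) 1 by (rule up_row2[OF i]) auto
    then show ?thesis using oc(1) oq(1)[OF i] mid[OF i] by blast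
  next
    case 2
    have "B = col3 M i \<or> B = mid3 M i \<or> (\<exists>j. 0 \<le> j \<and> j < M \<and> i \<noteq> j \<and> B = col2_hook M i j)"
      using C(2-4) unfolding C(5) 2 by (rule up_col2[OF i]) auto
    then show ?thesis using oc(2) oq(2)[OF i] mid[OF i] by blast
  next
    case 3
    note j = 3(1-3) and Cj = 3(4)
    have "B \<in> {row2_hook M i j, row2_hook M j i, col2_hook M i j, col2_hook M j i}
        \<or> (\<exists>l. 0 \<le> l \<and> l < M \<and> l \<noteq> i \<and> l \<noteq> j \<and> B = hooks3 M i j l)"
      using C(2-4) unfolding C(5) Cj by (rule up_hooks2[OF i j]) auto
    then show ?thesis
      using oq[OF i j] oq[OF j(1,2) i j(3)[symmetric]] h3[OF j] by blast
  qed
qed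

lemma odd_configs_subset: "odd_configs M \<subseteq> bead_sets n"
proof -
  have Mn: "3 * M = int n" by (simp add: M n)
  have "row2_hook M i j \<in> bead_sets n" "col2_hook M i j \<in> bead_sets n" if "(j, i) \<in> off_diagonal M" for i j
    using config_in_bead_sets(3,4)[OF Mn, of i j] that unfolding off_diagonal_def by simp_all
  moreover have "row3 M i \<in> bead_sets n" "col3 M i \<in> bead_sets n" if "i \<in> {0..<M}" for i
    using config_in_bead_sets(1,2)[OF Mn, of i] that by simp_all
  ultimately show ?thesis unfolding odd_configs_def by auto
qed

text \<open>Only one chain of two ribbons leads down to the hook. For \<open>row3\<close> no bead is
  passed; for \<open>col3\<close> the sign \<open>parity_sign (M - 1)\<close> occurs twice and
  cancels.\<close>

lemma sign4_bead_f_row3_col3: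
  assumes i: "0 \<le> i" "i < M"
  shows "sign4 (bead_f n (row3 M i)) = sign4 (F (desc (hook M i)))"
    "sign4 (bead_f n (col3 M i)) = sign4 (F (desc (hook M i)))"
proof -
  have "lower M (lower M F) (desc (row3 M i)) = F (desc (hook M i))"
    "lower M (lower M F) (desc (col3 M i)) = F (desc (hook M i))"
    using admissible_lower[OF admissible_F] M_pos
    by (simp_all add: lower_row3[OF _ i] lower_col3[OF _ i] lower_row2[OF admissible_F i]
        lower_col2[OF admissible_F i] parity_sign_def)
  then show "sign4 (bead_f n (row3 M i)) = sign4 (F (desc (hook M i)))"
    "sign4 (bead_f n (col3 M i)) = sign4 (F (desc (hook M i)))"
    using sign4_cong[OF bead_f_mod4[of "row3 M i"]] sign4_cong[OF bead_f_mod4[of "col3 M i"]] by simp_all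
qed

text \<open>Two removals reach the hook on runner \<open>j\<close> in one way and the hook on runner
  \<open>i\<close> in two ways, whose signs agree. The doubled term is 2 modulo 4, as hook values
  are odd, and adding 2 to an odd residue modulo 4 negates it. So the value on runner
  \<open>i\<close> drops out.\<close>

lemma sign4_bead_f_hook_pair:
  assumes i: "0 \<le> i" "i < M" and j: "0 \<le> j" "j < M" "i \<noteq> j"
  shows "sign4 (bead_f n (row2_hook M i j)) =
      - ((if i < j then - 1 else 1) * parity_sign i * sign4 (F (desc (hook M j))))"
    "sign4 (bead_f n (col2_hook M i j)) =
      - ((if i < j then - 1 else 1) * parity_sign i * sign4 (F (desc (hook M j))))"
proof -
  \<comment> \<open>Two distinct runners exist only if \<open>M > 1\<close>.\<close>
  have "a \<noteq> 0" using i j M m by (cases "a = 0") auto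
  then have ev: "even M" by (rule M_even)
  let ?d = "if i < j then - 1 else 1 :: int" and ?c = "\<lambda>k. F (desc (hook M k))"
  have eq: "lower M (lower M F) (desc (row2_hook M i j)) = ?d * (parity_sign i * ?c j + 2 * (parity_sign j * ?c i))"
    "lower M (lower M F) (desc (col2_hook M i j)) = ?d * (parity_sign i * ?c j + 2 * (parity_sign j * ?c i))"
    using admissible_lower[OF admissible_F] M_pos ev
    by (simp_all add: lower_row2_hook[OF _ i j] lower_col2_hook[OF _ i j] lower_hooks2[OF admissible_F i j]
       lower_row2[OF admissible_F i] lower_col2[OF admissible_F i] parity_sign_def)
  have "sign4 (?d * (parity_sign i * ?c j + 2 * (parity_sign j * ?c i))) = - (?d * parity_sign i * sign4 (?c j))"
  proof -
    have 1: "sign4 (x + 2 * y) = - sign4 x" if "odd x" "odd y" for x y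
      using that unfolding sign4_def by presburger
    have 2: "sign4 (parity_sign k * x) = parity_sign k * sign4 x" "sign4 (?d * x) = ?d * sign4 x" for k x
      by (simp_all add: parity_sign_def sign4_uminus)
    have "odd (parity_sign i * ?c j)" "odd (parity_sign j * ?c i)"
      using odd_F_hook i j by (simp_all add: parity_sign_def)
    then show ?thesis unfolding 2(2) using 1 2(1) by simp
  qed
  then show "sign4 (bead_f n (row2_hook M i j)) = - (?d * parity_sign i * sign4 (?c j))"
    "sign4 (bead_f n (col2_hook M i j)) = - (?d * parity_sign i * sign4 (?c j))"
    using sign4_cong[OF bead_f_mod4[of "row2_hook M i j"]] sign4_cong[OF bead_f_mod4[of "col2_hook M i j"]]
    unfolding eq by simp_all
qed

lemma sign4_bead_f_off_diagonal:
  assumes "(j, i) \<in> off_diagonal M"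
  shows "sign4 (bead_f n (row2_hook M i j)) =
      - ((if i < j then - 1 else 1) * parity_sign i * sign4 (F (desc (hook M j))))"
    "sign4 (bead_f n (col2_hook M i j)) =
      - ((if i < j then - 1 else 1) * parity_sign i * sign4 (F (desc (hook M j))))"
  using assms sign4_bead_f_hook_pair[of i j] unfolding off_diagonal_def by simp_all

text \<open>Stated for a general \<open>\<phi>\<close> in order to serve both the sum of
  \<open>sign4\<close> and the sum of its squares.\<close>

lemma sum_bead_sets:
  assumes "\<phi> 0 = (0 :: int)"
  shows "(\<Sum>B\<in>bead_sets n. \<phi> (sign4 (bead_f n B))) = (\<Sum>B\<in>odd_configs M. \<phi> (sign4 (bead_f n B)))"
proof (rule sum.mono_neutral_right[OF finite_bead_sets odd_configs_subset])
  have "\<phi> (sign4 (bead_f n B)) = 0" if "B \<in> bead_sets n" "B \<notin> odd_configs M" for B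
  proof -
    have "finite B" using that(1) by (simp add: bead_sets_def)
    then have "even (bead_f n B)" using odd_bead_f_imp that(2) by blast
    then show ?thesis using assms by (simp add: sign4_even)
  qed
  then show "\<forall>B\<in>bead_sets n - odd_configs M. \<phi> (sign4 (bead_f n B)) = 0" by blast
qed

lemma sum_off_diagonal:
  "(\<Sum>(j, i)\<in>off_diagonal M. g i j) = (\<Sum>j\<in>{0..<M}. \<Sum>i\<in>{0..<M} - {j}. g i j :: int)"
  unfolding off_diagonal_def by (subst sum.Sigma) auto

text \<open>Every member of \<open>odd_configs\<close> has an odd value, so the count is that of the
  index sets: \<open>2 M\<close> from one runner and \<open>2 M (M - 1)\<close> from ordered pairs
  of runners.\<close>

lemma a_cnt_sum: "int (a_cnt 1 n) + int (a_cnt 3 n) = 2 * M ^ 2"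
proof -
  have sq: "(sign4 (bead_f n B))\<^sup>2 = 1" if "odd (bead_f n B)" for B
    using sign4_odd[OF that] by auto
  have sqF: "(sign4 (F (desc (hook M i))))\<^sup>2 = 1" if "0 \<le> i" "i < M" for i
    using sign4_odd[OF odd_F_hook[OF that]] by auto
  have sqQ: "(sign4 (bead_f n (row2_hook M i j)))\<^sup>2 = 1" "(sign4 (bead_f n (col2_hook M i j)))\<^sup>2 = 1"
    if "(j, i) \<in> off_diagonal M" for i j
    using sqF[of j] that unfolding sign4_bead_f_off_diagonal[OF that] off_diagonal_def
    by (simp_all add: power_mult_distrib parity_sign_def)
  have "int (a_cnt 1 n) + int (a_cnt 3 n) = (\<Sum>B\<in>bead_sets n. (sign4 (bead_f n B))\<^sup>2)"
    using sum_sign4(2)[OF finite_bead_sets[of n], where f = "bead_f n"] by (simp add: a_cnt_bead_sets)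
  also have "\<dots> = (\<Sum>B\<in>odd_configs M. (sign4 (bead_f n B))\<^sup>2)"
    by (rule sum_bead_sets[where \<phi> = "\<lambda>x. x\<^sup>2"]) simp
  also have "\<dots> = (\<Sum>i\<in>{0..<M}. 1) + (\<Sum>i\<in>{0..<M}. 1)
     + (\<Sum>(j, i)\<in>off_diagonal M. 1) + (\<Sum>(j, i)\<in>off_diagonal M. 1)"
    unfolding sum_odd_configs
    by (intro arg_cong2[where f = "(+)"] sum.cong refl)
      (auto simp: sign4_bead_f_row3_col3 sqF sqQ)
  also have "\<dots> = 2 * M + 2 * (M * (M - 1))"
    using M_pos unfolding sum_off_diagonal by (simp add: of_nat_diff)
  finally show ?thesis by (simp add: algebra_simps power2_eq_square)
qed

text \<open>\<open>row3\<close> and \<open>col3\<close> contribute the hook sum once each. In the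
  two pair families the sum over \<open>i\<close> for fixed \<open>j\<close> is \<open>- 1\<close>,
  which the minus sign in front turns into 1, so each gives the hook sum again. For
  \<open>M = 1\<close> there are no pairs.\<close>

lemma delta_eq_sum:
  "delta n = (if a = 0 then 2 else 4) * (\<Sum>i\<in>{0..<M}. sign4 (F (desc (hook M i))))"
proof -
  let ?e = "\<lambda>i. sign4 (F (desc (hook M i)))"
  let ?d = "\<lambda>i j :: int. if i < j then - 1 else 1 :: int"
  have "delta n = (\<Sum>B\<in>bead_sets n. sign4 (bead_f n B))"
    using sum_sign4(1)[OF finite_bead_sets[of n], where f = "bead_f n"] by (simp add: delta_def a_cnt_bead_sets)
  also have "\<dots> = (\<Sum>B\<in>odd_configs M. sign4 (bead_f n B))"
    by (rule sum_bead_sets[where \<phi> = "\<lambda>x. x"]) simp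
  also have "\<dots> = (\<Sum>i\<in>{0..<M}. ?e i) + (\<Sum>i\<in>{0..<M}. ?e i)
     + (\<Sum>(j, i)\<in>off_diagonal M. - (?d i j * parity_sign i * ?e j))
     + (\<Sum>(j, i)\<in>off_diagonal M. - (?d i j * parity_sign i * ?e j))"
    unfolding sum_odd_configs
    by (intro arg_cong2[where f = "(+)"] sum.cong refl)
      (simp_all only: split_paired_all case_prod_conv atLeastLessThan_iff
        sign4_bead_f_row3_col3 sign4_bead_f_off_diagonal)
  also have "(\<Sum>(j, i)\<in>off_diagonal M. - (?d i j * parity_sign i * ?e j))
      = (\<Sum>j\<in>{0..<M}. - (\<Sum>i\<in>{0..<M} - {j}. ?d i j * parity_sign i) * ?e j)"
    unfolding sum_off_diagonal by (simp add: sum_negf sum_distrib_right)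
  also have "\<dots> = (if a = 0 then 0 else \<Sum>j\<in>{0..<M}. ?e j)"
  proof (cases "a = 0")
    case True
    then have "{0..<M} = {0}" by (auto simp: M m)
    then show ?thesis using True by simp
  next
    case False
    then show ?thesis using sum_signed_off_diagonal[OF M_even] by simp
  qed
  finally show ?thesis by simp
qed

text \<open>For even \<open>M\<close> the signs over all runners sum to 0, so flipping them on the
  upper half leaves twice the sum over the first \<open>h\<close> runners. This is 2 if
  \<open>h\<close> is odd, that is \<open>h = 1\<close>, and 0 otherwise.\<close>

lemma delta_value: "delta n = (if a = 0 then 2 else if a = 1 then 8 else 0)"
proof (cases a)
  case 0
  have "F = lower M (perm_sign n)" by (simp add: F M m 0)
  moreover have "{0..<M} = {0}" by (auto simp: M m 0)
  moreover have "lower M (perm_sign n) (desc (hook M 0)) = 1"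
    using lower_hook[OF admissible_perm_sign, of 0 M] by (simp add: perm_sign_ground M m 0 parity_sign_def)
  ultimately show ?thesis using 0 by (simp add: delta_eq_sum sign4_def)
next
  case (Suc b)
  define h :: int where "h = 2 ^ b"
  have h: "M = 2 * h" "0 < h" by (simp_all add: h_def M m Suc)
  then have hM: "h < M" by simp
  have "(\<Sum>i\<in>{0..<M}. sign4 (F (desc (hook M i)))) = (\<Sum>i\<in>{0..<h}. sign4 (F (desc (hook M i)))) + (\<Sum>i\<in>{h..<M}. sign4 (F (desc (hook M i))))"
    using h by (intro sum_int_interval_concat[symmetric]) auto
  also have "(\<Sum>i\<in>{0..<h}. sign4 (F (desc (hook M i)))) = (\<Sum>i\<in>{0..<h}. parity_sign i)"
    using sign4_F_hook[OF h(1)] hM by (intro sum.cong refl) simp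
  also have "(\<Sum>i\<in>{h..<M}. sign4 (F (desc (hook M i)))) = - (\<Sum>i\<in>{h..<M}. parity_sign i)"
    unfolding sum_negf[symmetric] using sign4_F_hook[OF h(1)] h(2) by (intro sum.cong refl) simp
  also have "(\<Sum>i\<in>{h..<M}. parity_sign i) = (\<Sum>i\<in>{0..<M}. parity_sign i) - (\<Sum>i\<in>{0..<h}. parity_sign i)"
    using sum_int_interval_concat[of 0 h M parity_sign] h by simp
  finally have "(\<Sum>i\<in>{0..<M}. sign4 (F (desc (hook M i)))) = (if odd h then 2 else 0)"
    using h by (simp add: sum_parity_sign_int)
  moreover have "odd h \<longleftrightarrow> b = 0" by (simp add: h_def)
  ultimately show ?thesis by (simp add: delta_eq_sum Suc)
qed

end

theorem theorem1p3:
  fixes R n :: nat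
  assumes "R \<ge> 1" and "n = 2 ^ R + 2 ^ (R - 1)"
  shows "delta n = (if n = 3 then 2 else if n = 6 then 8 else 0)
    \<and> (R = 1 \<longrightarrow> a_cnt 1 n = 2 \<and> a_cnt 3 n = 0)
    \<and> (R = 2 \<longrightarrow> a_cnt 1 n = 8 \<and> a_cnt 3 n = 0)
    \<and> (R \<ge> 3 \<longrightarrow> a_cnt 1 n = 4 ^ (R - 1) \<and> a_cnt 3 n = 4 ^ (R - 1))"
proof -
  obtain a where a: "R = Suc a" using assms(1) by (cases R) auto
  \<comment> \<open>Here \<open>2 ^ a\<close> is the \<open>M\<close> of the preceding part.\<close>
  have n: "n = 3 * 2 ^ a" by (simp add: assms(2) a)
  have "n = 3 \<longleftrightarrow> a = 0" by (simp add: n)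
  moreover have "n = 6 \<longleftrightarrow> a = 1"
    using power_inject_exp[of "2 :: nat" a 1] by (simp add: n)
  moreover have d: "delta n = (if a = 0 then 2 else if a = 1 then 8 else 0)"
    by (rule delta_value[OF refl refl n refl])
  moreover have s: "int (a_cnt 1 n) + int (a_cnt 3 n) = 2 * 4 ^ a"
    using a_cnt_sum[OF refl refl n refl] by (simp add: power2_eq_square flip: power_mult_distrib)
  \<comment> \<open>The counts follow from their sum \<open>2 M^2\<close> and their difference
    \<open>delta n\<close>.\<close>
  have "a_cnt 1 n = 4 ^ a \<and> a_cnt 3 n = 4 ^ a" if "2 \<le> a"
  proof -
    have "int (a_cnt 1 n) = int (4 ^ a)" "int (a_cnt 3 n) = int (4 ^ a)"
      using d s that by (auto simp: delta_def)
    then show ?thesis by (simp only: of_nat_eq_iff)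
  qed
  moreover have "a_cnt 1 n = 2 \<and> a_cnt 3 n = 0" if "a = 0"
    using d s that by (auto simp: delta_def)
  moreover have "a_cnt 1 n = 8 \<and> a_cnt 3 n = 0" if "a = 1"
    using d s that by (auto simp: delta_def)
  ultimately show ?thesis by (auto simp: a)
qed

end
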